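(* $R_1^{\Delta}(4,7)=13$, and up to isomorphism there are exactly two extremal graphs, namely $H_1$ and $H_2$ below. Both have vertex set $\{v_1,\dots,v_{12}\}$. The edges of $H_1$ are $v_1v_2, v_2v_3, v_3v_4, v_4v_5, v_5v_6, v_1v_6, v_1v_7, v_2v_8, v_3v_9, v_4v_{10}, v_5v_{11}, v_6v_{12}, v_{12}v_9, v_9v_{11}, v_{11}v_7, v_7v_{10}, v_{10}v_8, v_8v_{12}$. The edges of $H_2$ are $v_1v_2, v_1v_9, v_2v_7, v_2v_6, v_3v_4, v_3v_7, v_3v_8, v_4v_5, v_4v_9, v_5v_{10}, v_5v_6, v_{11}v_{12}, v_8v_9, v_9v_{10}, v_{10}v_{11}, v_8v_{12}, v_7v_{11}, v_6v_{12}$. That is, every triangle-free graph on $13$ vertices contains a $1$-dense set of $4$ vertices or a $1$-sparse set of $7$ vertices, and $H_1,H_2$ are, up to isomorphism, the only triangle-free graphs on $12$ vertices containing neither.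
   Context: All graphs are finite and simple. For an integer $k\ge0$, a set $S$ of vertices of a graph $G$ is $k$-sparse if the induced subgraph $G[S]$ has maximum degree at most $k$, and $k$-dense if every vertex of $S$ is non-adjacent to at most $k$ other vertices of $S$. $R_k^{\Delta}(i,j)$ denotes the least $n$ such that every triangle-free graph on $n$ vertices contains a $k$-dense set of $i$ vertices or a $k$-sparse set of $j$ vertices. An extremal graph for $R_k^{\Delta}(i,j)$ is a triangle-free graph on $R_k^{\Delta}(i,j)-1$ vertices containing neither a $k$-dense set of $i$ vertices nor a $k$-sparse set of $j$ vertices.
   Formalization: The edge v4v9 is deleted from the listed edges of H2 (leaving 17 edges): with it, v3v4, v4v9, v8v9, v3v8 form a 4-cycle, so {v3,v4,v8,v9} is a 1-dense set of 4 vertices and the listed H2 is not extremal. *)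

theory Defs
  imports "Graph_Theory.Graph_Theory"
begin

text \<open>
  A finite simple graph is a \<^locale>\<open>pair_graph\<close>: each edge $uv$ is represented by both of the
  arcs \<open>(u, v)\<close> and \<open>(v, u)\<close>, so degrees are out-degrees.
\<close>

definition triangle_free :: "'a pair_pre_digraph \<Rightarrow> bool" where
  "triangle_free G \<longleftrightarrow>
     \<not> (\<exists>u v w. (u, v) \<in> parcs G \<and> (v, w) \<in> parcs G \<and> (w, u) \<in> parcs G)"

definition sparse_set :: "nat \<Rightarrow> 'a pair_pre_digraph \<Rightarrow> 'a set \<Rightarrow> bool" where
  "sparse_set k G S \<longleftrightarrow>
     S \<subseteq> pverts G \<and> (\<forall>v\<in>S. out_degree (with_proj G \<restriction> S) v \<le> k)"

definition dense_set :: "nat \<Rightarrow> 'a pair_pre_digraph \<Rightarrow> 'a set \<Rightarrow> bool" where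
  "dense_set k G S \<longleftrightarrow>
     S \<subseteq> pverts G \<and> (\<forall>v\<in>S. card {u \<in> S. u \<noteq> v \<and> (v, u) \<notin> parcs G} \<le> k)"

definition has_dense_or_sparse :: "nat \<Rightarrow> nat \<Rightarrow> nat \<Rightarrow> 'a pair_pre_digraph \<Rightarrow> bool" where
  "has_dense_or_sparse k i j G \<longleftrightarrow>
     (\<exists>S. dense_set k G S \<and> card S = i) \<or> (\<exists>S. sparse_set k G S \<and> card S = j)"

text \<open>
  Every finite graph is isomorphic to one whose vertices are natural numbers, so it suffices to
  let \<open>G\<close> range over these.  The value is meaningful only if some such \<open>n\<close> exists.
\<close>

definition defective_ramsey_tf :: "nat \<Rightarrow> nat \<Rightarrow> nat \<Rightarrow> nat" where
  "defective_ramsey_tf k i j =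
     (LEAST n. \<forall>G :: nat pair_pre_digraph.
        pair_graph G \<and> triangle_free G \<and> card (pverts G) = n \<longrightarrow> has_dense_or_sparse k i j G)"

definition extremal_graph :: "nat \<Rightarrow> nat \<Rightarrow> nat \<Rightarrow> 'a pair_pre_digraph \<Rightarrow> bool" where
  "extremal_graph k i j G \<longleftrightarrow>
     pair_graph G \<and> triangle_free G \<and> card (pverts G) = defective_ramsey_tf k i j - 1 \<and>
     \<not> has_dense_or_sparse k i j G"

definition graph_iso :: "'a pair_pre_digraph \<Rightarrow> 'b pair_pre_digraph \<Rightarrow> bool" where
  "graph_iso G H \<longleftrightarrow> digraph_iso (with_proj G) (with_proj H)"

definition graph_of_edges :: "'a set \<Rightarrow> ('a \<times> 'a) set \<Rightarrow> 'a pair_pre_digraph" where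
  "graph_of_edges V E = \<lparr> pverts = V, parcs = E \<union> E\<inverse> \<rparr>"

definition H1 :: "nat pair_pre_digraph" where
  "H1 = graph_of_edges {1..12}
     {(1,2), (2,3), (3,4), (4,5), (5,6), (1,6), (1,7), (2,8), (3,9), (4,10), (5,11), (6,12),
      (12,9), (9,11), (11,7), (7,10), (10,8), (8,12)}"

text \<open>
  The edge list of $H_2$ in the source has in addition the edge $v_4v_9$.  That is a misprint:
  it would make $v_3v_4v_9v_8$ a 4-cycle, that is, a 1-dense set of 4 vertices.
\<close>

definition H2 :: "nat pair_pre_digraph" where
  "H2 = graph_of_edges {1..12}
     {(1,2), (1,9), (2,7), (2,6), (3,4), (3,7), (3,8), (4,5), (5,10), (5,6), (11,12),
      (8,9), (9,10), (10,11), (8,12), (7,11), (6,12)}"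

end

theory Submission
  imports Defs
begin

text \<open>
  In a triangle-free graph the 1-dense sets of 4 vertices are the 4-cycles, so the graphs in question
  have girth at least 5 and no 1-sparse set of 7 vertices.  A vertex $v$ can be added to every sparse
  set outside its closed neighbourhood $N[v]$, so $G - N[v]$ has no 1-sparse set of 6 vertices.  The
  graphs of girth at least 5 without such a set are enumerated by successively adding a vertex of
  maximum degree: there are none on 10 vertices, one on 9 and thirteen on 8.

  Let $G$ have 12 vertices.  Then all degrees are at least 2.  If $v$ has degree 2, then $G$ arises
  from the graph on 9 vertices by adding $v$ and its two neighbours, which gives $H_2$.  If all
  degrees are at least 3, then $G$ is cubic by the Moore bound, and it arises from a graph on 8
  vertices of minimum degree at least 2 by adding $v$ and its three neighbours, which gives $H_1$.
  A graph on 13 vertices would extend $H_1$ or $H_2$ by a vertex of maximum degree; no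
  such extension has girth at least 5.
\<close>

section \<open>Sparse sets in graphs of girth at least 5\<close>

text \<open>Maximum degree at most 1, phrased as uniqueness of the neighbour, so that no
  cardinalities enter.\<close>

definition sparse_in :: "('a \<times> 'a) set \<Rightarrow> 'a set \<Rightarrow> bool" where
  "sparse_in E S \<longleftrightarrow> (\<forall>x\<in>S. \<forall>y\<in>S. \<forall>z\<in>S. (x, y) \<in> E \<longrightarrow> (x, z) \<in> E \<longrightarrow> y = z)"

definition sparse_free :: "('a \<times> 'a) set \<Rightarrow> nat \<Rightarrow> 'a set \<Rightarrow> bool" where
  "sparse_free E s W \<longleftrightarrow> \<not> (\<exists>S\<subseteq>W. card S = s \<and> sparse_in E S)"

definition nbhd :: "('a \<times> 'a) set \<Rightarrow> 'a set \<Rightarrow> 'a \<Rightarrow> 'a set" where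
  "nbhd E W x = {y \<in> W. (x, y) \<in> E}"

lemma sparse_free_mono: "sparse_free E s W \<Longrightarrow> U \<subseteq> W \<Longrightarrow> sparse_free E s U"
  unfolding sparse_free_def by blast

text \<open>Only the edge relation is fixed. Vertex sets \<open>W\<close> are passed separately, so
  one relation serves all induced subgraphs.\<close>

locale girth5 =
  fixes E :: "('a \<times> 'a) set"
  assumes sym: "(x, y) \<in> E \<Longrightarrow> (y, x) \<in> E"
    and no_C3: "(x, y) \<in> E \<Longrightarrow> (y, z) \<in> E \<Longrightarrow> (x, z) \<notin> E"
    and no_C4: "(x, y) \<in> E \<Longrightarrow> (y, z) \<in> E \<Longrightarrow> (x, w) \<in> E \<Longrightarrow> (w, z) \<in> E \<Longrightarrow> x = z \<or> y = w"
begin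

lemma irrefl: "(x, x) \<notin> E"
  using no_C3 by blast

text \<open>An isolated vertex can be added to a sparse set.\<close>

lemma sparse_free_delete_closed_nbhd:
  assumes "sparse_free E (Suc s) W" "finite W" "v \<in> W"
  shows "sparse_free E s (W - insert v (nbhd E W v))"
  unfolding sparse_free_def
proof (rule notI, elim exE conjE)
  fix S assume S: "S \<subseteq> W - insert v (nbhd E W v)" "card S = s" "sparse_in E S"
  have "finite S" "v \<notin> S"
    using S(1) assms(2) finite_subset by blast+
  then have "card (insert v S) = Suc s"
    using S(2) by simp
  moreover have "sparse_in E (insert v S)"
    using S(1,3) sym irrefl unfolding sparse_in_def nbhd_def by blast
  moreover have "insert v S \<subseteq> W"
    using S(1) assms(3) by blast
  ultimately show False
    using assms(1) unfolding sparse_free_def by blast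
qed

text \<open>Each neighbour of \<open>v\<close> has at least two neighbours other than
  \<open>v\<close>. These lie outside the closed neighbourhood of \<open>v\<close>, as there are no
  triangles, and differ for different neighbours of \<open>v\<close>, as there are no
  4-cycles.\<close>

lemma moore_bound:
  assumes "finite W" "v \<in> W" and deg: "\<And>x. x \<in> W \<Longrightarrow> 3 \<le> card (nbhd E W x)"
  shows "3 * card (nbhd E W v) + 1 \<le> card W"
proof -
  let ?A = "nbhd E W v"
  let ?T = "SIGMA a:?A. nbhd E W a - {v}"
  have fin: "finite ?A" "\<And>a. finite (nbhd E W a - {v})"
    using assms(1) by (auto simp: nbhd_def)
  have "2 * card ?A = (\<Sum>a\<in>?A. 2)" by simp
  also have "\<dots> \<le> (\<Sum>a\<in>?A. card (nbhd E W a - {v}))"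
  proof (rule sum_mono)
    fix a assume "a \<in> ?A"
    then have "v \<in> nbhd E W a" "3 \<le> card (nbhd E W a)"
      using assms(2) sym deg by (auto simp: nbhd_def)
    then show "2 \<le> card (nbhd E W a - {v})"
      by (simp add: card_Diff_singleton)
  qed
  also have "\<dots> = card ?T"
    using fin by (simp add: card_SigmaI)
  also have "\<dots> \<le> card (W - insert v ?A)"
  proof (rule card_inj_on_le[where f = snd])
    show "inj_on snd ?T"
      by (rule inj_onI) (auto simp: nbhd_def dest: no_C4)
    show "snd ` ?T \<subseteq> W - insert v ?A"
      by (auto simp: nbhd_def dest: no_C3)
    show "finite (W - insert v ?A)"
      using assms(1) by simp
  qed
  also have "\<dots> = card W - card (insert v ?A)"
    by (rule card_Diff_subset) (use fin assms in \<open>auto simp: nbhd_def\<close>)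
  also have "card (insert v ?A) = Suc (card ?A)"
    using fin irrefl by (simp add: nbhd_def)
  finally have "2 * card ?A \<le> card W - Suc (card ?A)" .
  moreover have "card (insert v ?A) \<le> card W"
    by (rule card_mono) (use assms in \<open>auto simp: nbhd_def\<close>)
  ultimately show ?thesis
    using \<open>card (insert v ?A) = Suc (card ?A)\<close> by linarith
qed

end

section \<open>Coding and extending graphs\<close>

text \<open>A graph on \<open>{0..<n}\<close> is coded by the list whose \<open>i\<close>-th entry lists the neighbours \<open>j < i\<close>.\<close>

type_synonym rows = "nat list list"

definition adj :: "rows \<Rightarrow> nat \<Rightarrow> nat \<Rightarrow> bool" where
  "adj G i j = (if j < i then j \<in> set (G ! i) else if i < j then i \<in> set (G ! j) else False)"

definition deg :: "rows \<Rightarrow> nat \<Rightarrow> nat" where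
  "deg G i = length (filter (adj G i) [0..<length G])"

text \<open>For distinct \<open>i\<close> and \<open>j\<close> this is distance at least 3.\<close>

definition far :: "rows \<Rightarrow> nat \<Rightarrow> nat \<Rightarrow> bool" where
  "far G i j = (if adj G i j then False
     else list_all (\<lambda>k. if adj G i k then \<not> adj G j k else True) [0..<length G])"

text \<open>In girth at least 5 the neighbours of a new vertex have pairwise distance at least 3.\<close>

fun far_sets :: "rows \<Rightarrow> nat list \<Rightarrow> nat list list" where
  "far_sets G [] = [[]]"
| "far_sets G (i # is) =
     (let C = far_sets G is in C @ map ((#) i) (filter (list_all (far G i)) C))"

text \<open>\<open>P\<close> carries what is known about the new last vertex, such as maximality of
  its degree, and so prunes the candidates. Their order matters, since certificates are matched by
  position.\<close>

definition extensions :: "(rows \<Rightarrow> bool) \<Rightarrow> rows list \<Rightarrow> rows list" where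
  "extensions P L =
     filter P (concat (map (\<lambda>G. map (\<lambda>S. G @ [S]) (far_sets G [0..<length G])) L))"

text \<open>\<open>p ! i\<close> is the old label of the new vertex \<open>i\<close>. Rows come out
  increasing, so comparison with the stored codes is equality of lists.\<close>

definition relabel :: "nat list \<Rightarrow> rows \<Rightarrow> rows" where
  "relabel p G = map (\<lambda>i. filter (\<lambda>j. adj G (p ! i) (p ! j)) [0..<i]) [0..<length G]"

text \<open>
  A certificate either exhibits a sparse set, or relabels the graph to one on the list \<open>L\<close> while
  keeping the positions in \<open>F\<close>.
\<close>

datatype certificate = Sparse "nat list" | Relabel "nat list"

fun verify :: "nat \<Rightarrow> nat list \<Rightarrow> rows list \<Rightarrow> rows \<Rightarrow> certificate \<Rightarrow> bool" where
  "verify s F L G (Sparse T) \<longleftrightarrow> length T = s \<and> distinct T \<and> list_all (\<lambda>i. i < length G) T \<and>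
     list_all (\<lambda>i. length (filter (adj G i) T) \<le> 1) T"
| "verify s F L G (Relabel p) \<longleftrightarrow> length p = length G \<and> distinct p \<and> list_all (\<lambda>i. i < length G) p \<and>
     list_all (\<lambda>i. i < length G \<and> p ! i = i) F \<and> relabel p G \<in> set L"

text \<open>\<open>xs ! i\<close> is the vertex in position \<open>i\<close>. Pairs with
  \<open>j < i\<close> suffice, because symmetry of \<open>E\<close> settles the others.\<close>

definition represents :: "('a \<times> 'a) set \<Rightarrow> rows \<Rightarrow> 'a list \<Rightarrow> bool" where
  "represents E G xs \<longleftrightarrow> length xs = length G \<and> distinct xs \<and>
     (\<forall>i<length G. \<forall>j<i. (xs ! i, xs ! j) \<in> E \<longleftrightarrow> j \<in> set (G ! i))"

text \<open>\<open>F = []\<close> leaves \<open>v\<close> arbitrary, while \<open>F = [k]\<close>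
  roots the graph at \<open>v\<close> in position \<open>k\<close>.\<close>

definition listed :: "('a \<times> 'a) set \<Rightarrow> nat list \<Rightarrow> 'a \<Rightarrow> rows list \<Rightarrow> 'a set \<Rightarrow> bool" where
  "listed E F v L W \<longleftrightarrow>
     (\<exists>G\<in>set L. \<exists>xs. represents E G xs \<and> set xs = W \<and> (\<forall>i\<in>set F. i < length xs \<and> xs ! i = v))"

lemma listed_Nil [simp]: "\<not> listed E F v [] W"
  by (simp add: listed_def)

lemma representsD: "represents E G xs \<Longrightarrow> length xs = length G" "represents E G xs \<Longrightarrow> distinct xs"
  by (auto simp: represents_def)

lemma card_filter_nth:
  assumes "distinct xs" "length xs = n"
  shows "length (filter (\<lambda>i. Q (xs ! i)) [0..<n]) = card {y \<in> set xs. Q y}"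
proof -
  have "length (filter (\<lambda>i. Q (xs ! i)) [0..<n]) = length (filter Q (map ((!) xs) [0..<n]))"
    by (simp add: filter_map comp_def)
  also have "map ((!) xs) [0..<n] = xs"
    using assms(2) map_nth by blast
  also have "length (filter Q xs) = card (set (filter Q xs))"
    using assms(1) by (simp only: distinct_card distinct_filter)
  finally show ?thesis by (simp only: set_filter)
qed

text \<open>The recursion offers, for each index, to skip it or to take it. Following
  \<open>Q\<close> is one of these courses, since every index taken is far from those already
  taken.\<close>

lemma far_sets_complete:
  assumes "distinct is"
    and "\<And>i j. i \<in> set is \<Longrightarrow> j \<in> set is \<Longrightarrow> Q i \<Longrightarrow> Q j \<Longrightarrow> i \<noteq> j \<Longrightarrow> far G i j"
  shows "filter Q is \<in> set (far_sets G is)"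
  using assms
proof (induction "is")
  case (Cons a "is")
  then have IH: "filter Q is \<in> set (far_sets G is)" by simp
  show ?case
  proof (cases "Q a")
    case True
    then have "list_all (far G a) (filter Q is)"
      using Cons.prems by (auto simp: list_all_iff)
    then show ?thesis
      using IH True by (simp add: Let_def)
  qed (use IH in \<open>simp add: Let_def\<close>)
qed simp

section \<open>Soundness of codes, candidates and certificates\<close>

context girth5
begin

lemma adj_represents:
  assumes "represents E G xs" "i < length G" "j < length G"
  shows "adj G i j \<longleftrightarrow> (xs ! i, xs ! j) \<in> E"
proof (cases i j rule: linorder_cases)
  case less
  then have "(xs ! j, xs ! i) \<in> E \<longleftrightarrow> i \<in> set (G ! j)"
    using assms by (simp add: represents_def)
  then show ?thesis
    using less sym by (auto simp: adj_def)
next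
  case equal
  then show ?thesis using irrefl by (simp add: adj_def)
next
  case greater
  then show ?thesis using assms by (simp add: represents_def adj_def)
qed

lemma deg_represents:
  assumes "represents E G xs" "i < length G"
  shows "deg G i = card (nbhd E (set xs) (xs ! i))"
proof -
  have "filter (adj G i) [0..<length G] = filter (\<lambda>j. (xs ! i, xs ! j) \<in> E) [0..<length G]"
    using assms by (intro filter_cong) (auto simp: adj_represents)
  then show ?thesis
    using card_filter_nth[of xs "length G" "\<lambda>y. (xs ! i, y) \<in> E"] assms(1)
    by (simp add: deg_def nbhd_def represents_def)
qed

text \<open>Two neighbours of \<open>w\<close> that are adjacent or have another common neighbour
  would close a triangle or a 4-cycle through \<open>w\<close>. So the positions of the neighbours
  of \<open>w\<close> occur in \<open>far_sets\<close>.\<close>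

lemma represents_extend:
  assumes G: "represents E G xs" and "w \<notin> set xs"
  shows "\<exists>S \<in> set (far_sets G [0..<length G]). represents E (G @ [S]) (xs @ [w])"
proof
  let ?S = "filter (\<lambda>i. (xs ! i, w) \<in> E) [0..<length G]"
  have len: "length xs = length G" "distinct xs"
    using G by (simp_all add: represents_def)
  show "?S \<in> set (far_sets G [0..<length G])"
  proof (rule far_sets_complete)
    fix i j
    assume ij: "i \<in> set [0..<length G]" "j \<in> set [0..<length G]"
      and E: "(xs ! i, w) \<in> E" "(xs ! j, w) \<in> E" and "i \<noteq> j"
    then have ne: "xs ! i \<noteq> xs ! j" using len by (simp add: nth_eq_iff_index_eq)
    have "\<not> adj G i j"
      using ij E adj_represents[OF G] no_C3 sym by (metis atLeastLessThan_iff set_upt)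
    moreover have "\<not> adj G j k" if "k < length G" "adj G i k" for k
    proof
      assume "adj G j k"
      then have "(xs ! i, xs ! k) \<in> E" "(xs ! k, xs ! j) \<in> E"
        using that ij adj_represents[OF G] sym by auto
      \<comment> \<open>Both \<open>xs ! k\<close> and \<open>w\<close> are common neighbours of two
        distinct vertices.\<close>
      then have "xs ! k = w"
        using no_C4[of "xs ! i" "xs ! k" "xs ! j" w] E sym ne by blast
      then show False
        using that(1) len assms(2) nth_mem by metis
    qed
    ultimately show "far G i j" by (simp add: far_def list_all_iff)
  qed simp
  have "(w, xs ! j) \<in> E \<longleftrightarrow> j \<in> set ?S" if "j < length G" for j
    using that sym by auto
  then show "represents E (G @ [?S]) (xs @ [w])"
    using G assms(2) by (auto simp: represents_def nth_append less_Suc_eq)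
qed

lemma represents_relabel:
  assumes G: "represents E G xs" and p: "length p = length G" "distinct p" "\<forall>i\<in>set p. i < length G"
  shows "represents E (relabel p G) (map ((!) xs) p)" "set (map ((!) xs) p) = set xs"
proof -
  \<comment> \<open>\<open>p\<close> has as many distinct entries as there are positions, so it is a
    permutation.\<close>
  have "set p = {0..<length G}"
    by (rule card_subset_eq) (use p distinct_card[of p] in auto)
  then have "(!) xs ` set p = set xs"
    using representsD(1)[OF G] by (metis atLeastLessThan_upt list.set_map map_nth)
  then show set: "set (map ((!) xs) p) = set xs" by simp
  have "distinct (map ((!) xs) p)"
    using p representsD[OF G] by (auto simp: distinct_map inj_on_def nth_eq_iff_index_eq)
  moreover have "p ! i < length G" if "i < length G" for i
    using that p by (metis nth_mem)
  ultimately show "represents E (relabel p G) (map ((!) xs) p)"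
    using p by (auto simp: represents_def relabel_def adj_represents[OF G])
qed

text \<open>A certificate \<open>Sparse\<close> contradicts \<open>sparse_free\<close>, so only
  \<open>Relabel\<close> can occur, and it leads to a code in \<open>L\<close>.\<close>

lemma verify_sound:
  assumes G: "represents E G xs" and free: "sparse_free E s (set xs)" and v: "verify s F L G c"
    and F: "\<forall>i\<in>set F. xs ! i = v"
  shows "listed E F v L (set xs)"
proof (cases c)
  case (Sparse T)
  have T: "length T = s" "distinct T" "\<And>i. i \<in> set T \<Longrightarrow> i < length G"
    "\<And>i. i \<in> set T \<Longrightarrow> length (filter (adj G i) T) \<le> 1"
    using v Sparse by (auto simp: list_all_iff)
  have len: "length xs = length G" "distinct xs"
    using G by (simp_all add: represents_def)
  let ?S = "(!) xs ` set T"
  have inj: "inj_on ((!) xs) (set T)"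
    using T(3) len by (auto simp: inj_on_def nth_eq_iff_index_eq)
  have "card ?S = s"
    using inj T(1,2) by (simp add: card_image distinct_card)
  moreover have "?S \<subseteq> set xs"
    using T(3) len by auto
  moreover have "sparse_in E ?S"
  proof -
    have "j = k" if "i \<in> set T" "j \<in> set T" "k \<in> set T" "(xs ! i, xs ! j) \<in> E" "(xs ! i, xs ! k) \<in> E"
      for i j k
    proof -
      have "j \<in> set (filter (adj G i) T)" "k \<in> set (filter (adj G i) T)"
        using that T(3) adj_represents[OF G] by auto
      moreover have "card (set (filter (adj G i) T)) \<le> 1"
        using T(4)[OF that(1)] card_length le_trans by blast
      ultimately show ?thesis
        by (metis card_le_Suc0_iff_eq One_nat_def List.finite_set)
    qed
    then show ?thesis unfolding sparse_in_def by blast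
  qed
  ultimately show ?thesis
    using free unfolding sparse_free_def by blast
next
  case (Relabel p)
  have p: "length p = length G" "distinct p" "\<forall>i\<in>set p. i < length G"
    "\<forall>i\<in>set F. i < length G \<and> p ! i = i" "relabel p G \<in> set L"
    using v Relabel by (auto simp: list_all_iff)
  have "map ((!) xs) p ! i = v" if "i \<in> set F" for i
    using that p(1,4) F by simp
  then show ?thesis
    using represents_relabel[OF G p(1-3)] p(1,4,5) unfolding listed_def
    by (metis length_map)
qed

text \<open>The inductive step of all enumerations: the graph on \<open>insert w W\<close> is one of
  the candidates, and the certificate paired with that candidate places it in \<open>L'\<close>. The
  premise on \<open>P\<close> ensures that the filter does not lose it. Choosing \<open>F'\<close>
  empty forgets the root.\<close>

lemma listed_extend:
  assumes L: "listed E F v L W" and w: "w \<notin> W" and free: "sparse_free E s (insert w W)"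
    and P: "\<And>G xs. represents E G (xs @ [w]) \<Longrightarrow> set xs = W \<Longrightarrow>
      \<forall>i\<in>set F. i < length xs \<and> xs ! i = v \<Longrightarrow> P G"
    and F': "set F' \<subseteq> set F"
    and check: "list_all2 (verify s F' L') (extensions P L) cs"
  shows "listed E F' v L' (insert w W)"
proof -
  obtain G xs where G: "G \<in> set L" "represents E G xs" "set xs = W"
      "\<forall>i\<in>set F. i < length xs \<and> xs ! i = v"
    using L by (auto simp: listed_def)
  then obtain S where S: "S \<in> set (far_sets G [0..<length G])" "represents E (G @ [S]) (xs @ [w])"
    using represents_extend w by metis
  have "G @ [S] \<in> set (extensions P L)"
    using G S P[OF S(2)] by (auto simp: extensions_def)
  then obtain c where "verify s F' L' (G @ [S]) c"
    using check by (auto simp: list_all2_conv_all_nth in_set_conv_nth)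
  then have "listed E F' v L' (set (xs @ [w]))"
    using S(2) free G(3,4) F' by (intro verify_sound) (auto simp: nth_append)
  then show ?thesis using G(3) by simp
qed

text \<open>The deleted vertex \<open>v\<close> returns while its neighbours are still absent, hence
  with an empty row. It takes the first free position \<open>k\<close> and becomes the root.\<close>

lemma listed_add_isolated:
  assumes L: "listed E F u L W" and "v \<notin> W" "\<And>x. x \<in> W \<Longrightarrow> (v, x) \<notin> E" "card W = k"
  shows "listed E [k] v (map (\<lambda>G. G @ [[]]) L) (insert v W)"
proof -
  obtain G xs where G: "G \<in> set L" "represents E G xs" "set xs = W"
    using L by (auto simp: listed_def)
  then have "length xs = k" "length G = k"
    using assms(4) distinct_card[of xs] by (auto simp: represents_def)
  then have "represents E (G @ [[]]) (xs @ [v])" "(xs @ [v]) ! k = v" "k < length (xs @ [v])"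
    using G assms(2,3) by (auto simp: represents_def nth_append less_Suc_eq)
  moreover have "set (xs @ [v]) = insert v W"
    using G(3) by simp
  ultimately show ?thesis
    using G(1) unfolding listed_def
    by (metis (no_types, lifting) empty_iff empty_set image_eqI set_ConsD set_map)
qed

end

section \<open>Graphs without a sparse set of 6 vertices\<close>

text \<open>
  Each list \<open>codes\<close>$n$ represents all graphs of girth at least 5 on $n$ vertices without a
  1-sparse set of 6 vertices; there are none on 10 vertices.
\<close>

definition codes0 :: "rows list" where
  "codes0 =
    [[]]"

definition codes1 :: "rows list" where
  "codes1 =
    [[[]]]"

definition codes2 :: "rows list" where
  "codes2 =
    [[[],[]], [[],[0]]]"

definition codes3 :: "rows list" where
  "codes3 =
    [[[],[],[]], [[],[],[1]], [[],[],[0,1]]]"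

definition codes4 :: "rows list" where
  "codes4 =
    [[[],[],[],[]], [[],[],[],[2]], [[],[],[],[1,2]], [[],[],[],[0,1,2]], [[],[],[1],[0]],
    [[],[],[1],[0,2]]]"

definition codes5 :: "rows list" where
  "codes5 =
    [[[],[],[],[],[]], [[],[],[],[],[3]], [[],[],[],[],[2,3]], [[],[],[],[],[1,2,3]],
    [[],[],[],[],[0,1,2,3]], [[],[],[],[2],[1]], [[],[],[],[2],[1,3]], [[],[],[],[2],[0,1]],
    [[],[],[],[2],[0,1,3]], [[],[],[],[1,2],[0,2]], [[],[],[1],[0,2],[0,1]]]"

definition codes6 :: "rows list" where
  "codes6 =
    [[[],[],[],[],[],[3,4]], [[],[],[],[],[],[2,3,4]], [[],[],[],[],[],[1,2,3,4]],
    [[],[],[],[],[],[0,1,2,3,4]], [[],[],[],[],[3],[2,4]], [[],[],[],[],[3],[1,2]],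
    [[],[],[],[],[3],[1,2,4]], [[],[],[],[],[3],[0,1,2]], [[],[],[],[],[3],[0,1,2,4]],
    [[],[],[],[],[2,3],[1,3]], [[],[],[],[],[2,3],[0,1]], [[],[],[],[],[2,3],[0,1,4]],
    [[],[],[],[],[2,3],[0,1,3]], [[],[],[],[2],[1],[0,4]], [[],[],[],[2],[1],[0,3,4]],
    [[],[],[],[2],[1,3],[1,2]], [[],[],[],[2],[1,3],[0,2]], [[],[],[],[2],[1,3],[0,1,2]],
    [[],[],[],[1,2],[0,2],[0,1]]]"

definition codes7 :: "rows list" where
  "codes7 =
    [[[],[],[],[],[],[3,4],[1,2]], [[],[],[],[],[],[3,4],[1,2,5]], [[],[],[],[],[],[3,4],[1,2,4]],
    [[],[],[],[],[],[3,4],[0,1,2]], [[],[],[],[],[],[3,4],[0,1,2,5]],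
    [[],[],[],[],[],[3,4],[0,1,2,4]], [[],[],[],[],[],[2,3,4],[0,1,4]],
    [[],[],[],[],[3],[2,4],[2,3]], [[],[],[],[],[3],[2,4],[1,3]], [[],[],[],[],[3],[2,4],[1,2,3]],
    [[],[],[],[],[3],[2,4],[0,1]], [[],[],[],[],[3],[2,4],[0,1,5]], [[],[],[],[],[3],[2,4],[0,1,3]],
    [[],[],[],[],[3],[2,4],[0,1,2,3]], [[],[],[],[],[3],[1,2],[0,2,4]],
    [[],[],[],[],[3],[1,2,4],[0,2,3]], [[],[],[],[],[2,3],[1,3],[1,2]],
    [[],[],[],[],[2,3],[1,3],[0,2]], [[],[],[],[],[2,3],[1,3],[0,2,5]],
    [[],[],[],[],[2,3],[1,3],[0,1,2]], [[],[],[],[2],[1],[0,4],[0,1]],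
    [[],[],[],[2],[1],[0,4],[0,1,3]], [[],[],[],[2],[1],[0,3,4],[0,1,2]],
    [[],[],[],[2],[1,3],[0,2],[0,1]]]"

definition codes8 :: "rows list" where
  "codes8 =
    [[[],[],[],[],[],[3,4],[1,2,5],[0,2,4]], [[],[],[],[],[],[3,4],[1,2,4],[0,2,3]],
    [[],[],[],[],[3],[2,4],[2,3],[0,1]], [[],[],[],[],[3],[2,4],[2,3],[0,1,6]],
    [[],[],[],[],[3],[2,4],[1,3],[1,2]], [[],[],[],[],[3],[2,4],[1,3],[0,2,6]],
    [[],[],[],[],[3],[2,4],[1,3],[0,1,2]], [[],[],[],[],[3],[2,4],[1,2,3],[0,1,5]],
    [[],[],[],[],[3],[2,4],[0,1],[1,2,3]], [[],[],[],[],[3],[1,2],[0,2,4],[0,1,3]],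
    [[],[],[],[],[2,3],[1,3],[0,2],[0,1]], [[],[],[],[],[2,3],[1,3],[0,2],[0,1,4]],
    [[],[],[],[],[2,3],[1,3],[0,2,5],[0,1,4]]]"

definition codes9 :: "rows list" where
  "codes9 =
    [[[],[],[],[],[],[3,4],[1,2,5],[0,2,4],[0,1,3]]]"

text \<open>Deleting a vertex of maximum degree reverses such an extension, so this filter loses no
  graph.\<close>

definition max_last :: "rows \<Rightarrow> bool" where
  "max_last G = (let d = deg G (length G - 1) in list_all (\<lambda>i. deg G i \<le> d) [0..<length G])"

text \<open>The certificates are mere data: evaluation of \<open>verify\<close> checks each against
  the candidate in the same position, so it does not matter how they were found.\<close>

lemma check1: "list_all2 (verify 6 [] codes1) (extensions max_last codes0)
  [Relabel [0]]"
  by code_simp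

lemma check2: "list_all2 (verify 6 [] codes2) (extensions max_last codes1)
  [Relabel [0,1], Relabel [0,1]]"
  by code_simp

lemma check3: "list_all2 (verify 6 [] codes3) (extensions max_last codes2)
  [Relabel [0,1,2], Relabel [0,1,2], Relabel [1,0,2], Relabel [0,1,2]]"
  by code_simp

lemma check4: "list_all2 (verify 6 [] codes4) (extensions max_last codes3)
  [Relabel [0,1,2,3], Relabel [0,1,2,3], Relabel [0,2,1,3], Relabel [0,1,2,3], Relabel [1,2,0,3],
  Relabel [1,0,2,3], Relabel [2,0,1,3], Relabel [0,1,2,3], Relabel [0,1,2,3], Relabel [0,1,2,3],
  Relabel [0,2,1,3]]"
  by code_simp

lemma check5: "list_all2 (verify 6 [] codes5) (extensions max_last codes4)
  [Relabel [0,1,2,3,4], Relabel [0,1,2,3,4], Relabel [0,1,3,2,4], Relabel [0,1,2,3,4], Relabel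
  [0,2,3,1,4], Relabel [0,2,1,3,4], Relabel [0,3,1,2,4], Relabel [0,1,2,3,4], Relabel [1,2,3,0,4],
  Relabel [1,2,0,3,4], Relabel [1,3,0,2,4], Relabel [1,0,2,3,4], Relabel [2,3,0,1,4], Relabel
  [2,0,1,3,4], Relabel [3,0,1,2,4], Relabel [0,1,2,3,4], Relabel [0,1,2,3,4], Relabel [0,1,2,3,4],
  Relabel [0,1,3,2,4], Relabel [1,0,2,3,4], Relabel [1,0,2,3,4], Relabel [1,0,3,2,4], Relabel
  [0,1,2,3,4], Relabel [0,1,2,3,4], Relabel [0,1,3,2,4], Relabel [0,1,2,3,4], Relabel [0,2,1,3,4],
  Relabel [0,1,4,2,3], Relabel [0,2,4,1,3], Relabel [1,3,4,0,2], Relabel [2,3,4,0,1], Relabel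
  [0,1,2,3,4]]"
  by code_simp

text \<open>Six vertices are the first size at which a graph can be discarded, and then the sparse
  set is the whole vertex set.\<close>

lemma check6: "list_all2 (verify 6 [] codes6) (extensions max_last codes5)
  [Sparse [0,1,2,3,4,5], Sparse [0,1,2,3,4,5], Sparse [0,1,2,3,4,5], Relabel [0,1,2,3,4,5], Sparse
  [0,1,2,3,4,5], Relabel [0,1,3,2,4,5], Relabel [0,1,4,2,3,5], Relabel [0,1,2,3,4,5], Sparse
  [0,1,2,3,4,5], Relabel [0,2,3,1,4,5], Relabel [0,2,4,1,3,5], Relabel [0,2,1,3,4,5], Relabel
  [0,3,4,1,2,5], Relabel [0,3,1,2,4,5], Relabel [0,4,1,2,3,5], Relabel [0,1,2,3,4,5], Sparse
  [0,1,2,3,4,5], Relabel [1,2,3,0,4,5], Relabel [1,2,4,0,3,5], Relabel [1,2,0,3,4,5], Relabel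
  [1,3,4,0,2,5], Relabel [1,3,0,2,4,5], Relabel [1,4,0,2,3,5], Relabel [1,0,2,3,4,5], Relabel
  [2,3,4,0,1,5], Relabel [2,3,0,1,4,5], Relabel [2,4,0,1,3,5], Relabel [2,0,1,3,4,5], Relabel
  [3,4,0,1,2,5], Relabel [3,0,1,2,4,5], Relabel [4,0,1,2,3,5], Relabel [0,1,2,3,4,5], Sparse
  [0,1,2,3,4,5], Relabel [0,1,2,3,4,5], Relabel [0,1,2,4,3,5], Sparse [0,1,2,3,4,5], Relabel
  [0,2,1,3,4,5], Relabel [0,2,1,4,3,5], Relabel [0,1,2,3,4,5], Relabel [0,1,2,3,4,5], Relabel
  [0,1,2,4,3,5], Sparse [0,1,2,3,4,5], Relabel [1,2,0,3,4,5], Relabel [1,2,0,4,3,5], Relabel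
  [1,0,2,3,4,5], Relabel [1,0,2,3,4,5], Relabel [1,0,2,4,3,5], Relabel [2,0,1,3,4,5], Relabel
  [2,0,1,3,4,5], Relabel [2,0,1,4,3,5], Relabel [0,1,2,3,4,5], Relabel [0,1,2,3,4,5], Relabel
  [0,1,2,4,3,5], Relabel [0,1,2,3,4,5], Relabel [0,1,3,2,4,5], Relabel [1,0,2,3,4,5], Relabel
  [1,0,3,2,4,5], Relabel [0,1,2,3,4,5], Relabel [0,1,2,3,4,5], Relabel [0,1,2,3,4,5], Relabel
  [0,1,3,2,4,5], Relabel [0,1,2,5,3,4], Relabel [0,1,3,5,2,4], Relabel [0,2,4,5,1,3], Relabel
  [0,3,4,5,1,2], Sparse [0,1,2,3,4,5], Relabel [0,1,2,3,4,5], Relabel [0,2,1,4,3,5], Relabel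
  [0,1,2,3,4,5], Relabel [0,3,1,4,2,5], Relabel [0,1,3,2,4,5], Relabel [0,4,2,3,1,5], Relabel
  [0,2,4,1,3,5], Relabel [0,3,4,1,2,5], Relabel [0,1,2,3,4,5], Relabel [0,1,2,3,4,5], Relabel
  [0,2,1,4,3,5], Relabel [0,1,2,3,4,5], Relabel [0,2,1,5,3,4], Relabel [0,3,1,5,2,4], Relabel
  [1,2,0,5,3,4], Relabel [1,3,0,5,2,4], Relabel [0,1,2,3,4,5]]"
  by code_simp

lemma check7: "list_all2 (verify 6 [] codes7) (extensions max_last codes6)
  [Sparse [0,1,2,3,5,6], Sparse [0,1,2,4,5,6], Sparse [0,1,2,3,5,6], Sparse [0,1,2,4,5,6], Relabel
  [0,1,2,3,4,5,6], Relabel [0,1,2,3,4,5,6], Relabel [0,1,2,3,4,5,6], Relabel [0,1,2,4,3,5,6], Sparse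
  [0,1,2,3,5,6], Sparse [0,1,2,4,5,6], Relabel [1,0,2,3,4,5,6], Relabel [1,0,2,3,4,5,6], Relabel
  [1,0,2,3,4,5,6], Relabel [1,0,2,4,3,5,6], Relabel [2,0,1,3,4,5,6], Relabel [2,0,1,3,4,5,6],
  Relabel [2,0,1,3,4,5,6], Relabel [2,0,1,4,3,5,6], Relabel [0,1,2,3,4,5,6], Relabel
  [0,1,2,3,4,5,6], Relabel [0,1,2,3,4,5,6], Relabel [0,1,2,4,3,5,6], Relabel [0,1,2,3,4,5,6],
  Relabel [0,1,2,4,3,5,6], Relabel [0,1,3,4,2,5,6], Relabel [0,1,2,3,4,5,6], Relabel
  [0,1,2,3,4,5,6], Relabel [0,1,3,2,5,4,6], Relabel [0,1,2,3,4,5,6], Relabel [1,0,2,3,4,5,6],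
  Relabel [1,0,3,2,5,4,6], Relabel [1,0,2,3,4,5,6], Relabel [0,1,2,3,4,5,6], Relabel
  [0,1,2,3,4,5,6], Relabel [0,1,3,2,5,4,6], Relabel [0,1,2,3,4,5,6], Relabel [0,1,3,2,5,4,6],
  Relabel [0,1,2,3,4,5,6], Relabel [0,1,3,2,6,4,5], Relabel [0,1,4,2,6,3,5], Relabel
  [0,2,3,1,6,4,5], Relabel [0,2,4,1,6,3,5], Relabel [1,2,0,3,4,6,5], Relabel [1,2,0,3,4,6,5],
  Relabel [1,2,0,4,3,6,5], Relabel [1,2,0,4,3,6,5], Sparse [0,1,3,4,5,6], Relabel [0,1,2,3,4,5,6],
  Relabel [0,1,2,4,3,5,6], Sparse [0,2,3,4,5,6], Relabel [0,2,1,3,4,5,6], Relabel [0,2,1,4,3,5,6],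
  Relabel [0,1,2,3,4,5,6], Relabel [0,2,1,3,4,5,6], Relabel [0,1,2,3,4,5,6], Relabel
  [0,1,2,3,4,5,6], Relabel [0,1,2,3,4,5,6], Relabel [0,2,1,3,5,4,6], Relabel [0,2,1,3,5,4,6],
  Relabel [0,1,2,3,4,5,6], Relabel [0,2,1,3,6,4,5], Relabel [0,3,1,2,6,4,5], Relabel
  [1,2,0,3,6,4,5], Relabel [1,3,0,2,6,4,5], Relabel [0,2,4,6,1,3,5], Relabel [0,3,4,6,1,2,5],
  Relabel [1,2,5,6,0,3,4], Relabel [1,3,5,6,0,2,4], Relabel [0,1,2,3,4,5,6], Relabel
  [0,1,2,3,4,5,6], Relabel [0,1,3,2,4,5,6], Relabel [0,1,2,3,4,5,6], Relabel [0,1,2,3,4,5,6]]"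
  by code_simp

lemma check8: "list_all2 (verify 6 [] codes8) (extensions max_last codes7)
  [Sparse [0,1,2,3,5,7], Sparse [0,1,2,4,5,7], Sparse [0,1,2,3,5,7], Sparse [0,1,2,4,5,7], Sparse
  [0,1,2,3,4,7], Sparse [0,1,2,3,5,7], Sparse [0,1,2,3,5,7], Sparse [0,1,2,4,5,7], Sparse
  [0,1,2,4,5,7], Sparse [0,1,3,4,6,7], Sparse [0,1,3,4,6,7], Sparse [0,1,3,5,6,7], Sparse
  [0,1,4,5,6,7], Sparse [0,2,3,4,6,7], Sparse [0,2,3,4,6,7], Sparse [0,2,3,5,6,7], Sparse
  [0,2,4,5,6,7], Relabel [0,1,2,3,4,5,6,7], Relabel [0,1,2,4,3,5,6,7], Relabel [0,2,1,3,4,5,6,7],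
  Relabel [0,2,1,4,3,5,6,7], Relabel [1,0,2,3,4,5,7,6], Relabel [0,1,2,3,4,5,6,7], Relabel
  [2,0,1,3,4,5,7,6], Relabel [0,2,1,3,4,5,6,7], Relabel [0,1,2,3,4,5,6,7], Relabel
  [0,1,2,3,4,5,6,7], Relabel [0,1,2,4,3,6,5,7], Relabel [0,1,3,5,2,6,4,7], Relabel
  [0,1,4,6,2,5,3,7], Relabel [0,1,5,6,3,4,2,7], Relabel [0,1,2,3,4,5,6,7], Sparse [0,1,2,3,4,7],
  Sparse [0,1,4,5,6,7], Relabel [0,1,2,3,4,5,6,7], Sparse [0,1,4,5,6,7], Sparse [0,2,3,5,6,7],
  Relabel [0,2,1,4,3,6,5,7], Sparse [0,2,3,5,6,7], Relabel [0,1,2,3,4,5,6,7], Relabel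
  [0,1,2,3,4,5,6,7], Relabel [0,1,3,2,5,4,6,7], Relabel [0,1,2,3,4,5,7,6], Relabel
  [0,1,2,3,4,5,7,6], Sparse [0,2,3,5,6,7], Sparse [0,2,3,4,6,7], Relabel [0,1,2,3,4,5,6,7], Sparse
  [1,2,3,5,6,7], Sparse [1,2,3,4,6,7], Relabel [1,0,2,3,4,5,6,7], Relabel [0,1,2,3,4,5,7,6], Relabel
  [1,0,2,3,4,5,7,6], Relabel [1,2,0,4,3,7,6,5], Relabel [0,1,2,3,4,5,6,7], Sparse [0,1,2,4,5,7],
  Sparse [0,1,3,4,6,7], Sparse [0,2,3,5,6,7], Relabel [0,1,2,3,4,5,6,7], Relabel [0,1,2,3,4,5,6,7],
  Relabel [0,1,2,3,4,5,6,7]]"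
  by code_simp

lemma check9: "list_all2 (verify 6 [] codes9) (extensions max_last codes8)
  [Relabel [0,1,2,3,4,5,6,7,8], Relabel [2,0,1,3,4,5,8,6,7], Sparse [0,1,2,3,4,8], Sparse
  [0,1,2,3,5,8], Sparse [0,1,2,4,6,8], Sparse [0,1,3,4,7,8], Sparse [0,1,4,5,6,8], Sparse
  [0,2,3,4,7,8], Sparse [0,2,3,5,6,8], Sparse [1,2,3,4,7,8], Sparse [0,2,3,5,6,8], Sparse
  [0,1,2,3,4,8]]"
  by code_simp

text \<open>The empty certificate list forces the candidate list to be empty: girth and maximality
  of the degree alone exclude a tenth vertex.\<close>

lemma check10: "list_all2 (verify 6 [] []) (extensions max_last codes9) []"
  by code_simp

section \<open>Completion to 12 vertices\<close>

text \<open>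
  In \<open>rooted11\<close> a vertex $v$ sits at position 9, in \<open>cubic10\<close> and \<open>cubic11\<close> at position 8; the
  vertices after it are neighbours of $v$, and those before it are not.
\<close>

definition rooted11 :: "rows list" where
  "rooted11 =
    [[[],[],[],[],[],[3,4],[1,2,5],[0,2,4],[0,1,3],[],[2,3,9]]]"

text \<open>The first code is \<open>H1\<close> and the second is \<open>H2\<close>, with position
  \<open>i\<close> standing for vertex \<open>i + 1\<close>.\<close>

definition H_codes :: "rows list" where
  "H_codes =
    [[[],[0],[1],[2],[3],[0,4],[0],[1],[2],[3,6,7],[4,6,8],[5,7,8]],
    [[],[0],[],[2],[3],[1,4],[1,2],[2],[0,7],[4,8],[6,9],[5,7,10]]]"

definition cubic10 :: "rows list" where
  "cubic10 =
    [[[],[],[],[],[3],[1,2],[0,2,4],[0,1,3],[],[4,5,8]],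
    [[],[],[],[],[3],[1,2],[0,2,4],[0,1,3],[],[2,3,8]],
    [[],[],[],[],[3],[1,2],[0,2,4],[0,1,3],[],[0,5,8]],
    [[],[],[],[],[2,3],[1,3],[0,2],[0,1],[],[5,6,8]],
    [[],[],[],[],[2,3],[1,3],[0,2],[0,1,4],[],[5,6,8]],
    [[],[],[],[],[2,3],[1,3],[0,2],[0,1,4],[],[1,2,8]],
    [[],[],[],[],[2,3],[1,3],[0,2,5],[0,1,4],[],[1,2,8]]]"

definition cubic11 :: "rows list" where
  "cubic11 =
    [[[],[],[],[],[3],[1,2],[0,2,4],[0,1,3],[],[4,5,8],[2,3,8]],
    [[],[],[],[],[3],[1,2],[0,2,4],[0,1,3],[],[2,3,8],[1,4,8]],
    [[],[],[],[],[3],[1,2],[0,2,4],[0,1,3],[],[2,3,8],[0,5,8]],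
    [[],[],[],[],[2,3],[1,3],[0,2],[0,1],[],[5,6,8],[4,7,8]],
    [[],[],[],[],[2,3],[1,3],[0,2],[0,1],[],[5,6,8],[1,2,8]],
    [[],[],[],[],[2,3],[1,3],[0,2],[0,1,4],[],[5,6,8],[1,2,8]],
    [[],[],[],[],[2,3],[1,3],[0,2],[0,1,4],[],[1,2,8],[0,3,8]],
    [[],[],[],[],[2,3],[1,3],[0,2,5],[0,1,4],[],[1,2,8],[0,3,8]]]"

definition root_last :: "nat \<Rightarrow> rows \<Rightarrow> bool" where
  "root_last k G \<longleftrightarrow> k \<in> set (last G)"

text \<open>Describes an incomplete cubic graph. All neighbours of the new vertex are present
  already, so its degree is exactly 3, while other vertices may still wait for theirs.\<close>

definition subcubic_last :: "nat \<Rightarrow> rows \<Rightarrow> bool" where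
  "subcubic_last k G \<longleftrightarrow> k \<in> set (last G) \<and> deg G (length G - 1) = 3 \<and>
     list_all (\<lambda>i. deg G i \<le> 3) [0..<length G]"

definition cubic_last :: "nat \<Rightarrow> rows \<Rightarrow> bool" where
  "cubic_last k G \<longleftrightarrow> k \<in> set (last G) \<and> list_all (\<lambda>i. deg G i = 3) [0..<length G]"

definition min_deg2 :: "rows \<Rightarrow> bool" where
  "min_deg2 G = list_all (\<lambda>i. 2 \<le> deg G i) [0..<length G]"

text \<open>The size of sparse sets rises from 6 to 7, because the deleted vertex is back.
  Relabellings must keep it in position 9.\<close>

lemma check11: "list_all2 (verify 7 [9] rooted11) (extensions (root_last 9) (map (\<lambda>G. G @ [[]]) codes9))
  [Sparse [0,1,2,3,4,9,10], Sparse [0,1,2,3,4,9,10], Sparse [0,1,2,3,4,9,10], Sparse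
  [0,1,2,3,4,9,10], Sparse [0,1,2,3,4,9,10], Sparse [0,1,2,3,5,9,10], Sparse [0,1,2,3,5,9,10],
  Sparse [0,1,2,4,5,9,10], Sparse [0,1,2,4,5,9,10], Sparse [0,1,3,4,6,9,10], Sparse
  [0,1,3,4,6,9,10], Relabel [0,1,2,3,4,5,6,7,8,9,10], Sparse [0,2,3,4,6,9,10], Sparse
  [0,2,3,4,6,9,10], Relabel [0,2,1,4,3,5,6,8,7,9,10], Sparse [1,2,3,5,7,9,10], Sparse
  [1,2,3,5,7,9,10], Sparse [1,3,4,6,7,9,10]]"
  by code_simp

text \<open>The root is now complete and need not be followed further. In the only surviving
  candidate it has degree 2, so that candidate is \<open>H2\<close> and not the cubic
  \<open>H1\<close>.\<close>

lemma check12: "list_all2 (verify 7 [] H_codes) (extensions (root_last 9) rooted11)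
  [Sparse [0,1,2,3,4,9,11], Sparse [0,1,2,3,4,9,11], Sparse [0,1,2,3,4,9,11], Sparse
  [0,1,2,3,4,9,11], Sparse [0,1,2,3,4,9,11], Sparse [0,1,2,3,5,9,11], Sparse [0,1,2,3,5,9,11],
  Sparse [0,1,2,4,5,10,11], Sparse [0,1,2,4,5,10,11], Relabel [0,7,10,9,11,4,2,3,8,1,6,5], Sparse
  [0,1,2,4,5,10,11], Sparse [0,1,2,4,5,10,11], Sparse [0,1,3,4,6,10,11]]"
  by code_simp

lemma cubic_check10: "list_all2 (verify 7 [8] cubic10) (extensions (subcubic_last 8) (map (\<lambda>G. G @ [[]]) (filter min_deg2 codes8)))
  [Relabel [0,1,2,3,4,5,6,7,8,9], Relabel [0,2,1,4,3,5,7,6,8,9], Relabel [0,1,2,3,4,5,6,7,8,9],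
  Relabel [0,2,1,4,3,5,7,6,8,9], Relabel [0,1,2,3,4,5,6,7,8,9], Relabel [0,1,2,3,4,5,6,7,8,9],
  Relabel [0,2,1,3,5,4,7,6,8,9], Sparse [0,1,2,4,5,8,9], Sparse [0,1,2,4,5,8,9], Sparse
  [0,1,3,4,6,8,9], Sparse [0,1,3,4,6,8,9], Sparse [0,2,3,5,7,8,9], Sparse [0,2,3,5,7,8,9], Relabel
  [4,5,6,7,0,1,2,3,8,9], Sparse [1,2,3,6,7,8,9], Sparse [1,2,3,6,7,8,9], Relabel
  [4,6,5,7,1,0,3,2,8,9], Relabel [0,1,2,3,4,5,6,7,8,9], Sparse [0,1,2,4,5,8,9], Sparse
  [0,1,3,4,6,8,9], Sparse [0,2,3,5,7,8,9], Relabel [0,1,2,3,4,5,6,7,8,9], Sparse [1,2,3,6,7,8,9],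
  Relabel [1,0,3,2,4,6,5,7,8,9], Relabel [0,1,2,3,4,5,6,7,8,9], Relabel [1,0,3,2,4,6,5,7,8,9]]"
  by code_simp

lemma cubic_check11: "list_all2 (verify 7 [8] cubic11) (extensions (subcubic_last 8) cubic10)
  [Relabel [0,1,2,3,4,5,6,7,8,9,10], Relabel [0,1,2,3,4,5,6,7,8,10,9], Relabel
  [0,1,2,3,4,5,6,7,8,9,10], Relabel [0,1,2,3,4,5,6,7,8,9,10], Relabel [0,1,2,3,4,5,6,7,8,10,9],
  Relabel [0,2,1,4,3,5,7,6,8,10,9], Relabel [0,1,2,3,4,5,6,7,8,9,10], Sparse [0,1,2,4,5,8,10],
  Sparse [0,1,3,4,6,8,10], Sparse [0,2,3,5,7,8,10], Relabel [0,1,2,3,4,5,6,7,8,9,10], Sparse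
  [1,2,3,6,7,8,10], Relabel [1,0,3,2,4,6,5,7,8,9,10], Relabel [0,1,2,3,4,5,6,7,8,9,10], Relabel
  [1,0,3,2,4,6,5,7,8,9,10], Relabel [0,1,2,3,4,5,6,7,8,10,9], Sparse [0,1,2,4,5,8,10], Sparse
  [1,2,3,6,7,8,10], Relabel [0,1,2,3,4,5,6,7,8,9,10], Relabel [0,1,2,3,4,5,6,7,8,9,10]]"
  by code_simp

text \<open>All degrees are 3 here, so each of the four relabellings leads to
  \<open>H1\<close>.\<close>

lemma cubic_check12: "list_all2 (verify 7 [] H_codes) (extensions (cubic_last 8) cubic11)
  [Relabel [0,11,8,9,3,7,6,5,10,2,4,1], Relabel [0,10,8,9,3,7,6,5,11,2,4,1], Relabel
  [0,7,1,5,9,6,11,4,10,3,8,2], Relabel [0,7,1,5,11,6,10,4,9,3,8,2]]"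
  by code_simp

text \<open>As for ten vertices above, girth and maximality of the degree leave no
  candidate.\<close>

lemma check13: "extensions max_last H_codes = []"
  by code_simp

section \<open>Classification\<close>

context girth5
begin

lemma max_last_represents:
  assumes G: "represents E G (xs @ [w])"
    and max: "\<And>x. x \<in> insert w (set xs) \<Longrightarrow>
      card (nbhd E (insert w (set xs)) x) \<le> card (nbhd E (insert w (set xs)) w)"
  shows "max_last G"
proof -
  have len: "length G = Suc (length xs)"
    using representsD(1)[OF G] by simp
  have "deg G i = card (nbhd E (insert w (set xs)) ((xs @ [w]) ! i))" if "i < length G" for i
    using deg_represents[OF G that] by simp
  moreover have "(xs @ [w]) ! i \<in> insert w (set xs)" if "i < length G" for i
    using that len nth_mem[of i "xs @ [w]"] by simp
  ultimately show ?thesis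
    using max len by (simp add: max_last_def list_all_iff)
qed

definition classified :: "nat \<Rightarrow> nat \<Rightarrow> rows list \<Rightarrow> bool" where
  "classified s n L \<longleftrightarrow>
     (\<forall>W v. finite W \<longrightarrow> card W = n \<longrightarrow> sparse_free E s W \<longrightarrow> listed E [] v L W)"

text \<open>A vertex \<open>w\<close> of maximum degree is removed. The rest inherits
  \<open>sparse_free\<close>, is listed by hypothesis, and its extension by \<open>w\<close> passes
  \<open>max_last\<close>.\<close>

lemma classified_Suc:
  assumes IH: "classified s n L"
    and check: "list_all2 (verify s [] L') (extensions max_last L) cs"
  shows "classified s (Suc n) L'"
  unfolding classified_def
proof (intro allI impI)
  fix W v
  assume W: "finite W" "card W = Suc n" "sparse_free E s W"
  let ?d = "\<lambda>x. card (nbhd E W x)"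
  have "finite (?d ` W)" "?d ` W \<noteq> {}"
    using W by auto
  then obtain w where w: "w \<in> W" "?d w = Max (?d ` W)"
    by (metis (no_types, lifting) Max_in imageE)
  then have max: "?d x \<le> ?d w" if "x \<in> W" for x
    using W(1) that by simp
  have ins: "insert w (W - {w}) = W"
    using w by blast
  have "listed E [] v L (W - {w})"
    using W w sparse_free_mono[OF W(3)] IH by (auto simp: classified_def)
  then have "listed E [] v L' (insert w (W - {w}))"
  proof (rule listed_extend)
    show "max_last G" if "represents E G (xs @ [w])" "set xs = W - {w}" for G xs
      using that max ins by (intro max_last_represents) auto
  qed (use check ins W in auto)
  then show "listed E [] v L' W" using ins by simp
qed

section \<open>The enumeration from 0 to 10 vertices\<close>

lemma classified_codes0: "classified 6 0 codes0"
  by (auto simp: classified_def listed_def codes0_def represents_def)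

lemma classified_codes1: "classified 6 1 codes1"
  using classified_Suc[OF classified_codes0 check1] by simp

lemma classified_codes2: "classified 6 2 codes2"
  using classified_Suc[OF classified_codes1 check2] by (simp add: numeral_2_eq_2)

lemma classified_codes3: "classified 6 3 codes3"
  using classified_Suc[OF classified_codes2 check3] by simp

lemma classified_codes4: "classified 6 4 codes4"
  using classified_Suc[OF classified_codes3 check4] by simp

lemma classified_codes5: "classified 6 5 codes5"
  using classified_Suc[OF classified_codes4 check5] by simp

lemma classified_codes6: "classified 6 6 codes6"
  using classified_Suc[OF classified_codes5 check6] by simp

lemma classified_codes7: "classified 6 7 codes7"
  using classified_Suc[OF classified_codes6 check7] by simp

lemma classified_codes8: "classified 6 8 codes8"
  using classified_Suc[OF classified_codes7 check8] by simp

lemma classified_codes9: "classified 6 9 codes9"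
  using classified_Suc[OF classified_codes8 check9] by simp

lemma not_sparse_free_10: "finite W \<Longrightarrow> card W = 10 \<Longrightarrow> \<not> sparse_free E 6 W"
  using classified_Suc[OF classified_codes9 check10] by (auto simp: classified_def)

lemma root_last_represents:
  assumes G: "represents E G (xs @ [w])" and k: "k < length xs" "(w, xs ! k) \<in> E"
  shows "root_last k G"
proof -
  have len: "length G = Suc (length xs)"
    using representsD(1)[OF G] by simp
  then have "((xs @ [w]) ! length xs, (xs @ [w]) ! k) \<in> E \<longleftrightarrow> k \<in> set (G ! length xs)"
    using G k(1) unfolding represents_def by (metis lessI)
  moreover have "last G = G ! length xs"
    using len by (metis last_conv_nth diff_Suc_1 length_0_conv nat.distinct(1))
  ultimately show ?thesis
    using k by (simp add: root_last_def nth_append)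
qed

lemma listed_extend_rooted:
  assumes "listed E [k] v L W" "w \<notin> W" "(w, v) \<in> E" "sparse_free E s (insert w W)"
    and "list_all2 (verify s F' L') (extensions (root_last k) L) cs" "set F' \<subseteq> {k}"
  shows "listed E F' v L' (insert w W)"
  using assms by (intro listed_extend[where P = "root_last k" and F = "[k]"])
    (auto intro: root_last_represents)

lemma all_deg_represents:
  assumes G: "represents E G xs" and "\<And>x. x \<in> set xs \<Longrightarrow> Q (card (nbhd E (set xs) x))"
  shows "list_all (\<lambda>i. Q (deg G i)) [0..<length G]"
  using assms deg_represents[OF G] representsD(1)[OF G] by (auto simp: list_all_iff)

lemma card_nbhd_mono: "finite W \<Longrightarrow> U \<subseteq> W \<Longrightarrow> card (nbhd E U x) \<le> card (nbhd E W x)"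
  by (rule card_mono) (auto simp: nbhd_def)

text \<open>Removing \<open>v\<close> and its two neighbours leaves 9 vertices without a sparse
  6-set. The three vertices are then put back, \<open>v\<close> first, so that adjacency to
  \<open>v\<close> restricts the candidates for the other two.\<close>

lemma listed_H_codes_of_degree_2:
  assumes W: "finite W" "card W = 12" "sparse_free E 7 W"
    and v: "v \<in> W" "card (nbhd E W v) = 2"
  shows "listed E [] u H_codes W"
proof -
  obtain a b where ab: "nbhd E W v = {a, b}" "a \<noteq> b"
    using v(2) by (meson card_2_iff)
  then have adj: "(a, v) \<in> E" "(b, v) \<in> E" "a \<in> W" "b \<in> W" "a \<noteq> v" "b \<noteq> v"
    using sym irrefl by (auto simp: nbhd_def)
  let ?U = "W - {v, a, b}"
  have card: "card ?U = 9"
    using W v ab adj by (simp add: card_Diff_subset)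
  have "sparse_free E 6 ?U"
    using sparse_free_delete_closed_nbhd[of 6 W v] W v ab by simp
  then have "listed E [] v codes9 ?U"
    using W card classified_codes9 by (simp add: classified_def)
  moreover have "(v, x) \<notin> E" if "x \<in> ?U" for x
    using that ab by (auto simp: nbhd_def)
  \<comment> \<open>Positions start at 0, so \<open>v\<close> comes to position 9, behind the 9
    vertices of \<open>?U\<close>.\<close>
  ultimately have "listed E [9] v (map (\<lambda>G. G @ [[]]) codes9) (insert v ?U)"
    using card by (intro listed_add_isolated) auto
  then have "listed E [9] v rooted11 (insert a (insert v ?U))"
    using adj v W by (intro listed_extend_rooted[OF _ _ _ sparse_free_mono[OF W(3)] check11]) auto
  then have "listed E [] v H_codes (insert b (insert a (insert v ?U)))"
    using adj v W ab by (intro listed_extend_rooted[OF _ _ _ sparse_free_mono[OF W(3)] check12]) auto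
  moreover have "insert b (insert a (insert v ?U)) = W"
    using adj v by blast
  ultimately show ?thesis
    by (simp add: listed_def)
qed

lemma subcubic_last_represents:
  assumes G: "represents E G (xs @ [w])" and k: "k < length xs" "(w, xs ! k) \<in> E"
    and "card (nbhd E (insert w (set xs)) w) = 3"
    and "\<And>x. x \<in> insert w (set xs) \<Longrightarrow> card (nbhd E (insert w (set xs)) x) \<le> 3"
  shows "subcubic_last k G"
proof -
  have "length G = Suc (length xs)"
    using representsD(1)[OF G] by simp
  then have "deg G (length G - 1) = 3"
    using deg_represents[OF G, of "length xs"] assms(4) by simp
  then show ?thesis
    using root_last_represents[OF G k] all_deg_represents[OF G, of "\<lambda>d. d \<le> 3"] assms(5)
    by (simp add: subcubic_last_def root_last_def)
qed

text \<open>Since \<open>U\<close> contains all neighbours of \<open>w\<close>, the degree of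
  \<open>w\<close> is already its final degree 3. Degrees in the smaller set are at most those in
  \<open>W\<close>.\<close>

lemma listed_extend_subcubic:
  assumes L: "listed E [k] v L U" and w: "w \<notin> U" "(w, v) \<in> E"
    and W: "finite W" "insert w U \<subseteq> W" "sparse_free E s W"
    and cubic: "\<And>x. x \<in> W \<Longrightarrow> card (nbhd E W x) = 3" and nbhd: "nbhd E W w \<subseteq> U"
    and check: "list_all2 (verify s [k] L') (extensions (subcubic_last k) L) cs"
  shows "listed E [k] v L' (insert w U)"
proof (rule listed_extend[OF L w(1) sparse_free_mono[OF W(3,2)] _ _ check])
  fix G xs
  assume G: "represents E G (xs @ [w])" "set xs = U" "\<forall>i\<in>set [k]. i < length xs \<and> xs ! i = v"
  have "nbhd E (insert w U) w = nbhd E W w"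
    using nbhd W(2) by (auto simp: nbhd_def)
  then have "card (nbhd E (insert w U) w) = 3"
    using cubic W(2) by simp
  moreover have "card (nbhd E (insert w U) x) \<le> 3" if "x \<in> insert w U" for x
    using card_nbhd_mono[OF W(1,2), of x] cubic[of x] that W(2) by auto
  ultimately show "subcubic_last k G"
    using subcubic_last_represents[OF G(1), of k] G(2,3) w(2) by simp
qed simp

lemma listed_H_codes_cubic:
  assumes W: "finite W" "card W = 12" "sparse_free E 7 W"
    and cubic: "\<And>x. x \<in> W \<Longrightarrow> card (nbhd E W x) = 3"
  shows "listed E [] u H_codes W"
proof -
  obtain v where v: "v \<in> W"
    using W(2) by fastforce
  obtain a b c where abc: "nbhd E W v = {a, b, c}" "a \<noteq> b" "b \<noteq> c" "a \<noteq> c"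
    using cubic[OF v] by (metis card_3_iff)
  then have adj: "(a, v) \<in> E" "(b, v) \<in> E" "(c, v) \<in> E" "a \<in> W" "b \<in> W" "c \<in> W"
      "a \<noteq> v" "b \<noteq> v" "c \<noteq> v"
    using sym irrefl by (auto simp: nbhd_def)
  \<comment> \<open>An edge among them would form a triangle with \<open>v\<close>. So each of
    \<open>a\<close>, \<open>b\<close>, \<open>c\<close> has all its neighbours in
    \<open>insert v ?U\<close>.\<close>
  have far: "(a, b) \<notin> E" "(a, c) \<notin> E" "(b, c) \<notin> E"
    using adj no_C3 sym by blast+
  let ?U = "W - {v, a, b, c}"
  have card: "card ?U = 8"
    using W v abc adj by (simp add: card_Diff_subset)
  have nonadj: "(v, x) \<notin> E" if "x \<in> ?U" for x
    using that abc by (auto simp: nbhd_def)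
  have "sparse_free E 6 ?U"
    using sparse_free_delete_closed_nbhd[of 6 W v] W v abc by simp
  then have L8: "listed E [] v codes8 ?U"
    using W card classified_codes8 by (simp add: classified_def)
  have U_deg: "2 \<le> card (nbhd E ?U x)" if x: "x \<in> ?U" for x
  proof -
    \<comment> \<open>Two neighbours of \<open>x\<close> among \<open>a\<close>, \<open>b\<close>,
      \<open>c\<close> would form a 4-cycle with \<open>v\<close>. If there is none, any
      \<open>y\<close> will do.\<close>
    obtain y where y: "nbhd E W x \<inter> {v, a, b, c} \<subseteq> {y}"
      using no_C4[of x _ v] nonadj[OF x] adj x sym unfolding nbhd_def by blast
    have "card (nbhd E W x) \<le> card (insert y (nbhd E ?U x))"
      using y W by (intro card_mono) (auto simp: nbhd_def)
    also have "\<dots> \<le> Suc (card (nbhd E ?U x))"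
      by (rule card_insert_le_m1) auto
    finally show ?thesis
      using cubic x by simp
  qed
  have "listed E [] v (filter min_deg2 codes8) ?U"
  proof -
    obtain G xs where G: "G \<in> set codes8" "represents E G xs" "set xs = ?U"
      using L8 by (auto simp: listed_def)
    have "min_deg2 G"
      unfolding min_deg2_def
    proof (rule all_deg_represents[OF G(2), of "\<lambda>d. 2 \<le> d"])
      show "2 \<le> card (nbhd E (set xs) x)" if "x \<in> set xs" for x
        using U_deg that unfolding G(3) .
    qed
    then show ?thesis
      using G by (auto simp: listed_def)
  qed
  then have "listed E [8] v (map (\<lambda>G. G @ [[]]) (filter min_deg2 codes8)) (insert v ?U)"
    using card nonadj by (intro listed_add_isolated) auto
  then have "listed E [8] v cubic10 (insert a (insert v ?U))"
    using W adj v far irrefl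
    by (intro listed_extend_subcubic[OF _ _ _ W(1) _ W(3) cubic _ cubic_check10]) (auto simp: nbhd_def)
  then have "listed E [8] v cubic11 (insert b (insert a (insert v ?U)))"
    using W adj v far irrefl sym abc
    by (intro listed_extend_subcubic[OF _ _ _ W(1) _ W(3) cubic _ cubic_check11]) (auto simp: nbhd_def)
  \<comment> \<open>With \<open>c\<close> the graph is complete, so all degrees can be required to
    equal 3.\<close>
  then have "listed E [] v H_codes (insert c (insert b (insert a (insert v ?U))))"
  proof (rule listed_extend[OF _ _ _ _ _ cubic_check12])
    have W_eq: "insert c (insert b (insert a (insert v ?U))) = W"
      using v adj by blast
    show "cubic_last 8 G" if G: "represents E G (xs @ [c])"
      "set xs = insert b (insert a (insert v ?U))" "\<forall>i\<in>set [8]. i < length xs \<and> xs ! i = v" for G xs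
      using root_last_represents[OF G(1), of 8] all_deg_represents[OF G(1), of "\<lambda>d. d = 3"]
        G(2,3) adj cubic W_eq
      by (simp add: cubic_last_def root_last_def)
  qed (use adj v abc in \<open>auto intro: sparse_free_mono[OF W(3)]\<close>)
  moreover have "insert c (insert b (insert a (insert v ?U))) = W"
    using v adj by blast
  ultimately show ?thesis
    by (simp add: listed_def)
qed

text \<open>The cases are minimum degree at most 1, equal to 2, and at least 3. In the first, at
  least 10 vertices remain outside a closed neighbourhood, which the enumeration excludes.\<close>

theorem listed_H_codes:
  assumes W: "finite W" "card W = 12" "sparse_free E 7 W"
  shows "listed E [] u H_codes W"
proof (cases "\<exists>v\<in>W. card (nbhd E W v) \<le> 2")
  case True
  then obtain v where v: "v \<in> W" "card (nbhd E W v) \<le> 2" by blast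
  show ?thesis
  proof (cases "card (nbhd E W v) = 2")
    case True
    then show ?thesis using listed_H_codes_of_degree_2 W v by blast
  next
    case False
    let ?A = "insert v (nbhd E W v)"
    have "card ?A \<le> Suc (card (nbhd E W v))"
      by (rule card_insert_le_m1) auto
    then have "card ?A \<le> 2"
      using v False by linarith
    moreover have "card (W - ?A) = card W - card ?A"
      by (rule card_Diff_subset) (use W v in \<open>auto simp: nbhd_def\<close>)
    ultimately have "10 \<le> card (W - ?A)"
      using W by linarith
    then obtain U where U: "U \<subseteq> W - ?A" "card U = 10" "finite U"
      by (meson obtain_subset_with_card_n)
    have "sparse_free E 6 (W - ?A)"
      using sparse_free_delete_closed_nbhd[of 6 W v] W v by simp
    then have "sparse_free E 6 U"
      using U(1) sparse_free_mono by blast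
    then show ?thesis
      using not_sparse_free_10 U by blast
  qed
next
  case False
  then have deg: "3 \<le> card (nbhd E W x)" if "x \<in> W" for x
    using that by force
  \<comment> \<open>The Moore bound \<open>3 * d + 1 \<le> 12\<close> gives
    \<open>d \<le> 3\<close>.\<close>
  have "card (nbhd E W x) = 3" if "x \<in> W" for x
    using moore_bound[OF W(1) that deg] W(2) deg[OF that] by linarith
  then show ?thesis
    using listed_H_codes_cubic W by blast
qed

theorem not_sparse_free_13:
  assumes "finite W" "card W = 13"
  shows "\<not> sparse_free E 7 W"
proof -
  have "classified 7 12 H_codes"
    using listed_H_codes by (simp add: classified_def)
  \<comment> \<open>There are no candidates by \<open>check13\<close>, so the empty list of codes
    covers all sets of 13 vertices.\<close>
  then have "classified 7 13 []"
    using classified_Suc[of 7 12 H_codes "[]" "[]"] check13 by simp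
  then show ?thesis
    using assms by (auto simp: classified_def)
qed

end

section \<open>Translation to graphs as digraphs\<close>

lemma sparse_set_1_iff:
  assumes "finite S"
  shows "sparse_set 1 G S \<longleftrightarrow> S \<subseteq> pverts G \<and> sparse_in (parcs G) S"
proof -
  have "out_degree (with_proj G \<restriction> S) v = card {u \<in> S. (v, u) \<in> parcs G}" if "v \<in> S" for v
  proof -
    have "out_arcs (with_proj G \<restriction> S) v = Pair v ` {u \<in> S. (v, u) \<in> parcs G}"
      using that by (auto simp: out_arcs_def)
    then show ?thesis
      by (simp add: out_degree_def card_image inj_on_def)
  qed
  then show ?thesis
    using assms by (auto simp: sparse_set_def sparse_in_def card_le_Suc0_iff_eq)
qed

text \<open>In a 4-cycle a vertex can be non-adjacent only to the opposite one.\<close>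

lemma dense_set_C4:
  assumes E: "(a, b) \<in> parcs G" "(b, c) \<in> parcs G" "(c, d) \<in> parcs G" "(d, a) \<in> parcs G"
    and sym: "sym (parcs G)" and S: "{a, b, c, d} \<subseteq> pverts G"
  shows "dense_set 1 G {a, b, c, d}"
proof -
  have "(b, a) \<in> parcs G" "(c, b) \<in> parcs G" "(d, c) \<in> parcs G" "(a, d) \<in> parcs G"
    using E by (simp_all add: symD[OF sym])
  then have "{u \<in> {a, b, c, d}. u \<noteq> a \<and> (a, u) \<notin> parcs G} \<subseteq> {c}"
    "{u \<in> {a, b, c, d}. u \<noteq> b \<and> (b, u) \<notin> parcs G} \<subseteq> {d}"
    "{u \<in> {a, b, c, d}. u \<noteq> c \<and> (c, u) \<notin> parcs G} \<subseteq> {a}"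
    "{u \<in> {a, b, c, d}. u \<noteq> d \<and> (d, u) \<notin> parcs G} \<subseteq> {b}"
    using E by blast+
  then have "card {u \<in> {a, b, c, d}. u \<noteq> v \<and> (v, u) \<notin> parcs G} \<le> 1" if "v \<in> {a, b, c, d}" for v
    using that card_mono[of "{_}"] by fastforce
  then show ?thesis
    using S by (auto simp: dense_set_def)
qed

text \<open>In a 1-dense 4-set each vertex is adjacent to at least two others. Two neighbours of one
  vertex are non-adjacent, as there are no triangles, so both are adjacent to the fourth vertex, and
  a 4-cycle arises.\<close>

lemma (in girth5) not_dense_set_4:
  assumes G: "parcs G = E" and S: "card S = 4"
  shows "\<not> dense_set 1 G S"
proof
  assume dense: "dense_set 1 G S"
  have fin: "finite S"
    using S card.infinite by fastforce
  have one: "u = w" if "v \<in> S" "u \<in> S" "w \<in> S" "u \<noteq> v" "w \<noteq> v" "(v, u) \<notin> E" "(v, w) \<notin> E"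
    for u v w
  proof -
    have "card {u \<in> S. u \<noteq> v \<and> (v, u) \<notin> E} \<le> 1"
      using dense that(1) G by (simp add: dense_set_def)
    then show ?thesis
      using that fin by (simp add: card_le_Suc0_iff_eq)
  qed
  obtain a b c d where abcd: "S = {a, b, c, d}" "distinct [a, b, c, d]"
    using S by (auto simp: card_Suc_eq numeral_eq_Suc)
  then have S4: "a \<in> S" "b \<in> S" "c \<in> S" "d \<in> S" by auto
  have two: "(x, y) \<in> E \<or> (x, z) \<in> E" if "x \<in> S" "y \<in> S" "z \<in> S" "x \<noteq> y" "x \<noteq> z" "y \<noteq> z" for x y z
    using one that by metis
  have C4: False if "x \<in> S" "y \<in> S" "z \<in> S" "w \<in> S" "distinct [x, y, z, w]"
      "(x, y) \<in> E" "(x, z) \<in> E" for x y z w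
  proof -
    have "(y, z) \<notin> E" "(z, y) \<notin> E"
      using that no_C3 sym by blast+
    then have "(y, w) \<in> E" "(z, w) \<in> E"
      using two[of y z w] two[of z y w] that by auto
    then show False
      using no_C4[of x y w z] that by auto
  qed
  have "(a, b) \<in> E \<or> (a, c) \<in> E" "(a, b) \<in> E \<or> (a, d) \<in> E" "(a, c) \<in> E \<or> (a, d) \<in> E"
    using two S4 abcd by auto
  then show False
    using C4[of a b c d] C4[of a b d c] C4[of a c d b] S4 abcd by auto
qed

section \<open>Pair graphs, the girth condition and isomorphisms\<close>

lemma pair_graph_sym: "pair_graph G \<Longrightarrow> sym (parcs G)"
  by (auto intro: symI pair_sym_digraph.arcs_symmetric dest: pair_graph.axioms
      pair_pseudo_graph.axioms)

lemma pair_graph_arcs_subset: "pair_graph G \<Longrightarrow> parcs G \<subseteq> pverts G \<times> pverts G"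
proof -
  assume "pair_graph G"
  then interpret pair_graph G .
  show ?thesis by (auto dest: in_arcsD1 in_arcsD2)
qed

lemma pair_graph_finite: "pair_graph G \<Longrightarrow> finite (pverts G)"
proof -
  assume "pair_graph G"
  then interpret pair_graph G .
  show ?thesis by (rule pair_finite_verts)
qed

lemma pair_graphI:
  assumes "finite V" "E \<subseteq> V \<times> V" "sym E" "irrefl E"
  shows "pair_graph \<lparr>pverts = V, parcs = E\<rparr>"
proof unfold_locales
  show "finite (parcs \<lparr>pverts = V, parcs = E\<rparr>)"
    using assms finite_subset by fastforce
qed (use assms in \<open>auto simp: symmetric_def irrefl_def\<close>)

text \<open>Given triangle-freeness, dense 4-sets exist exactly when 4-cycles do, by
  \<open>dense_set_C4\<close> and \<open>not_dense_set_4\<close>.\<close>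

lemma not_has_dense_or_sparse_iff:
  assumes G: "pair_graph G" "triangle_free G"
  shows "\<not> has_dense_or_sparse 1 4 7 G \<longleftrightarrow> girth5 (parcs G) \<and> sparse_free (parcs G) 7 (pverts G)"
proof -
  have sparse: "(\<exists>S. sparse_set 1 G S \<and> card S = 7) \<longleftrightarrow> \<not> sparse_free (parcs G) 7 (pverts G)"
    \<comment> \<open>Infinite sets have cardinality 0, so a set of cardinality 7 is finite.\<close>
    using sparse_set_1_iff[of _ G] card.infinite unfolding sparse_free_def
    by (metis zero_neq_numeral)
  have "girth5 (parcs G)" if nd: "\<not> (\<exists>S. dense_set 1 G S \<and> card S = 4)"
  proof
    fix x y z w
    show "(y, x) \<in> parcs G" if "(x, y) \<in> parcs G"
      using that symD[OF pair_graph_sym[OF G(1)]] by simp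
    show no_C3: "(x, z) \<notin> parcs G" if "(x, y) \<in> parcs G" "(y, z) \<in> parcs G" for x y z
      using that G(2) symD[OF pair_graph_sym[OF G(1)]] unfolding triangle_free_def by blast
    assume E: "(x, y) \<in> parcs G" "(y, z) \<in> parcs G" "(x, w) \<in> parcs G" "(w, z) \<in> parcs G"
    then have E': "(z, w) \<in> parcs G" "(w, x) \<in> parcs G"
      by (simp_all add: symD[OF pair_graph_sym[OF G(1)]])
    show "x = z \<or> y = w"
    proof (rule ccontr)
      assume "\<not> (x = z \<or> y = w)"
      moreover have "x \<noteq> y" "y \<noteq> z" "z \<noteq> w" "w \<noteq> x"
        using E E' no_C3 by blast+
      ultimately have "card {x, y, z, w} = 4"
        by auto
      moreover have "dense_set 1 G {x, y, z, w}"
        using E E' pair_graph_arcs_subset[OF G(1)] by (intro dense_set_C4 pair_graph_sym G) auto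
      ultimately show False
        using nd by blast
    qed
  qed
  then show ?thesis
    using sparse girth5.not_dense_set_4[OF _ refl, of G] unfolding has_dense_or_sparse_def by blast
qed

lemma graph_iso_of_represents:
  assumes G: "pair_graph G" "girth5 (parcs G)" "represents (parcs G) R xs" "set xs = pverts G"
    and H: "pair_graph H" "girth5 (parcs H)" "represents (parcs H) R ys" "set ys = pverts H"
  shows "graph_iso G H"
proof -
  have len: "length xs = length R" "length ys = length R" "distinct xs" "distinct ys"
    using G(3) H(3) by (auto simp: represents_def)
  \<comment> \<open>\<open>f\<close> matches vertices in equal positions. Outside
    \<open>set xs\<close> its value is arbitrary.\<close>
  define f where "f x = the (map_of (zip xs ys) x)" for x
  have f: "f (xs ! i) = ys ! i" if "i < length R" for i
    using that len by (simp add: f_def map_of_zip_nth)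
  have xs: "\<exists>i<length R. x = xs ! i" if "x \<in> pverts G" for x
    using that G(4) len by (metis in_set_conv_nth)
  have ys: "\<exists>i<length R. x = ys ! i" if "x \<in> pverts H" for x
    using that H(4) len by (metis in_set_conv_nth)
  have E: "(xs ! i, xs ! j) \<in> parcs G \<longleftrightarrow> (ys ! i, ys ! j) \<in> parcs H"
    if "i < length R" "j < length R" for i j
    using that girth5.adj_represents[OF G(2,3)] girth5.adj_represents[OF H(2,3)] by blast
  have inj: "inj_on f (pverts G)"
    by (rule inj_onI) (use xs f len nth_eq_iff_index_eq in \<open>metis (no_types, lifting)\<close>)
  have verts: "f ` pverts G = pverts H"
  proof -
    have "map f xs = ys"
      using f len by (intro nth_equalityI) auto
    then show ?thesis
      using G(4) H(4) by (metis list.set_map)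
  qed
  have arcs: "map_prod f f ` parcs G = parcs H"
  proof (intro equalityI subsetI)
    fix e assume "e \<in> map_prod f f ` parcs G"
    then obtain x y where xy: "(x, y) \<in> parcs G" "e = (f x, f y)" by auto
    then obtain i j where "i < length R" "x = xs ! i" "j < length R" "y = xs ! j"
      using xs pair_graph_arcs_subset[OF G(1)] by blast
    then show "e \<in> parcs H" using E f xy by simp
  next
    fix e assume e: "e \<in> parcs H"
    then obtain i j where "i < length R" "j < length R" "e = (ys ! i, ys ! j)"
      using ys pair_graph_arcs_subset[OF H(1)] by blast
    then show "e \<in> map_prod f f ` parcs G"
      using E f e by (intro image_eqI[of _ _ "(xs ! i, xs ! j)"]) auto
  qed
  \<comment> \<open>A digraph isomorphism also acts on arcs. Arcs are pairs here, so
    \<open>f\<close> is applied to both ends.\<close>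
  let ?h = "\<lparr>iso_verts = f, iso_arcs = map_prod f f, iso_head = snd, iso_tail = fst\<rparr>"
  have "wf_digraph (with_proj G)"
    using pair_graph.pair_graphD_graph[OF G(1)]
    by (simp add: graph_def digraph_def fin_digraph_def)
  moreover have "inj_on (map_prod f f) (parcs G)"
    using map_prod_inj_on[OF inj inj] pair_graph_arcs_subset[OF G(1)] by (rule inj_on_subset)
  ultimately have "pre_digraph.digraph_isomorphism (with_proj G) ?h"
    using inj by (simp add: pre_digraph.digraph_isomorphism_def)
  moreover have "with_proj H = app_iso ?h (with_proj G)"
    using verts arcs by (simp add: app_iso_def with_proj_def)
  ultimately show ?thesis
    unfolding graph_iso_def digraph_iso_def by blast
qed

text \<open>The invariant that separates \<open>H1\<close> from \<open>H2\<close>.\<close>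

lemma graph_iso_card_arcs: "graph_iso G H \<Longrightarrow> card (parcs G) = card (parcs H)"
proof -
  assume "graph_iso G H"
  then obtain h where h: "pre_digraph.digraph_isomorphism (with_proj G) h"
      "with_proj H = app_iso h (with_proj G)"
    by (auto simp: graph_iso_def digraph_iso_def)
  have "parcs H = iso_arcs h ` parcs G"
    using arg_cong[OF h(2), of arcs] by simp
  moreover have "inj_on (iso_arcs h) (parcs G)"
    using h(1) by (simp add: pre_digraph.digraph_isomorphism_def)
  ultimately show ?thesis
    by (simp add: card_image)
qed

section \<open>The two extremal graphs\<close>

definition arc_list :: "(nat \<times> nat) list \<Rightarrow> (nat \<times> nat) list" where
  "arc_list es = es @ map prod.swap es"

text \<open>Paths on three vertices with the centre in the middle. The order of the ends makes each
  path occur in one direction only. Sparse sets are those that contain no such path.\<close>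

definition path_list :: "(nat \<times> nat) list \<Rightarrow> (nat \<times> nat \<times> nat) list" where
  "path_list es = concat (map (\<lambda>a. map (\<lambda>b. (snd a, fst a, snd b))
     (filter (\<lambda>b. fst b = fst a \<and> snd a < snd b) (arc_list es))) (arc_list es))"

text \<open>Bounded search tree for a hitting set of size \<open>k\<close>: such a set contains one
  of the three vertices of the first triple, and the triples hit by it are discarded. The empty
  family is hit by the empty set.\<close>

fun unhittable :: "nat \<Rightarrow> (nat \<times> nat \<times> nat) list \<Rightarrow> bool" where
  "unhittable k [] \<longleftrightarrow> False"
| "unhittable 0 (p # ps) \<longleftrightarrow> True"
| "unhittable (Suc k) ((a, b, c) # ps) \<longleftrightarrow>
     list_all (\<lambda>v. unhittable k (filter (\<lambda>(x, y, z). x \<noteq> v \<and> y \<noteq> v \<and> z \<noteq> v) ps)) [a, b, c]"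

lemma unhittable_sound:
  assumes "unhittable k ps" "finite R" "card R \<le> k"
  shows "\<exists>(x, y, z) \<in> set ps. x \<notin> R \<and> y \<notin> R \<and> z \<notin> R"
  using assms
proof (induction k ps arbitrary: R rule: unhittable.induct)
  case (2 p ps)
  then show ?case by (cases p) auto
next
  case (3 k a b c ps)
  show ?case
  proof (cases "\<exists>v \<in> {a, b, c}. v \<in> R")
    case True
    \<comment> \<open>One vertex of \<open>R\<close> is spent on the first triple, so
      \<open>k\<close> vertices are left for the triples that avoid \<open>v\<close>. In the other
      case the first triple itself avoids \<open>R\<close>.\<close>
    then obtain v where v: "v \<in> {a, b, c}" "v \<in> R" by blast
    have "\<exists>(x, y, z) \<in> set (filter (\<lambda>(x, y, z). x \<noteq> v \<and> y \<noteq> v \<and> z \<noteq> v) ps).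
        x \<notin> R - {v} \<and> y \<notin> R - {v} \<and> z \<notin> R - {v}"
    proof (rule "3.IH")
      show "card (R - {v}) \<le> k"
        using 3 v by (simp add: card_Diff_singleton)
    qed (use 3 v in auto)
    then show ?thesis by auto
  qed auto
qed simp

text \<open>The second check excludes triangles, as the ends of a path are not adjacent. The third
  excludes 4-cycles, as no two paths have the same ends. All checks are executable.\<close>

locale edge_list =
  fixes es :: "(nat \<times> nat) list" and n :: nat
  assumes check: "list_all (\<lambda>(x, y). 1 \<le> x \<and> x \<le> n \<and> 1 \<le> y \<and> y \<le> n \<and> x \<noteq> y) es"
    "list_all (\<lambda>(x, y, z). (x, z) \<notin> set (arc_list es)) (path_list es)"
    "distinct (map (\<lambda>(x, y, z). (x, z)) (path_list es))"
begin

abbreviation "G \<equiv> graph_of_edges {1..n} (set es)"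

lemma parcs_eq: "parcs G = set (arc_list es)"
  by (auto simp: graph_of_edges_def arc_list_def)

lemma pverts_eq: "pverts G = {1..n}"
  by (simp add: graph_of_edges_def)

lemma sym: "(x, y) \<in> parcs G \<Longrightarrow> (y, x) \<in> parcs G"
  by (auto simp: graph_of_edges_def)

lemma arcs: "(x, y) \<in> parcs G \<Longrightarrow> x \<in> {1..n} \<and> y \<in> {1..n} \<and> x \<noteq> y"
  using check(1) by (auto simp: graph_of_edges_def list_all_iff)

lemma path_iff: "(x, y, z) \<in> set (path_list es) \<longleftrightarrow> (y, x) \<in> parcs G \<and> (y, z) \<in> parcs G \<and> x < z"
proof
  assume "(x, y, z) \<in> set (path_list es)"
  then obtain a b where "a \<in> parcs G" "b \<in> parcs G" "fst b = fst a" "snd a < snd b"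
      "(x, y, z) = (snd a, fst a, snd b)"
    unfolding path_list_def parcs_eq by auto
  then show "(y, x) \<in> parcs G \<and> (y, z) \<in> parcs G \<and> x < z"
    by (metis Pair_inject prod.collapse)
next
  assume "(y, x) \<in> parcs G \<and> (y, z) \<in> parcs G \<and> x < z"
  then show "(x, y, z) \<in> set (path_list es)"
    unfolding path_list_def parcs_eq
    by (auto intro!: bexI[of _ "(y, x)"] image_eqI[of _ _ "(y, z)"])
qed

lemma path_no_arc: "(x, y, z) \<in> set (path_list es) \<Longrightarrow> (x, z) \<notin> parcs G"
  using check(2) unfolding parcs_eq list_all_iff by blast

lemma pair_graph_induced: "X \<subseteq> {1..n} \<Longrightarrow> pair_graph \<lparr>pverts = X, parcs = parcs G \<inter> X \<times> X\<rparr>"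
proof (rule pair_graphI)
  show "sym (parcs G \<inter> X \<times> X)"
    by (rule symI) (use sym in blast)
  show "irrefl (parcs G \<inter> X \<times> X)"
    by (rule irreflI) (use arcs in blast)
qed (auto intro: finite_subset)

lemma girth5: "girth5 (parcs G)"
proof
  fix x y z w
  show "(y, x) \<in> parcs G" if "(x, y) \<in> parcs G"
    using sym that .
  show "(x, z) \<notin> parcs G" if "(x, y) \<in> parcs G" "(y, z) \<in> parcs G"
  proof
    assume xz: "(x, z) \<in> parcs G"
    then have "x < z \<or> z < x"
      using arcs[OF xz] by linarith
    then have "(x, y, z) \<in> set (path_list es) \<or> (z, y, x) \<in> set (path_list es)"
      using that that[THEN sym] by (simp add: path_iff)
    then show False
      using path_no_arc[of x y z] path_no_arc[of z y x] xz sym[OF xz] by satx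
  qed
  have inj: "inj_on (\<lambda>(x, y, z). (x, z)) (set (path_list es))"
    using check(3) by (simp add: distinct_map)
  \<comment> \<open>Paths are listed with increasing ends only. The case \<open>z < x\<close>
    follows by reversing all arcs.\<close>
  have less: "y = w" if "(x, y) \<in> parcs G" "(y, z) \<in> parcs G" "(x, w) \<in> parcs G" "(w, z) \<in> parcs G" "x < z"
    for x z
  proof -
    have "(x, y, z) \<in> set (path_list es)" "(x, w, z) \<in> set (path_list es)"
      using that that(1,3)[THEN sym] by (simp_all add: path_iff)
    then show ?thesis
      using inj_onD[OF inj, of "(x, y, z)" "(x, w, z)"] by simp
  qed
  assume E: "(x, y) \<in> parcs G" "(y, z) \<in> parcs G" "(x, w) \<in> parcs G" "(w, z) \<in> parcs G"
  then show "x = z \<or> y = w"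
    using less[OF E] less[OF E(2,1,4,3)[THEN sym]] linorder_less_linear[of x z] by satx
qed

text \<open>The complement of a set of \<open>s\<close> vertices has at most \<open>k\<close>
  elements and cannot meet every path, so some path lies inside the set.\<close>

lemma sparse_freeI:
  assumes "unhittable k (path_list es)" "n \<le> k + s"
  shows "sparse_free (parcs G) s {1..n}"
  unfolding sparse_free_def
proof (rule notI, elim exE conjE)
  fix S assume S: "S \<subseteq> {1..n}" "card S = s" "sparse_in (parcs G) S"
  have "card ({1..n} - S) \<le> k"
    using S(1,2) assms(2) by (subst card_Diff_subset) (auto intro: finite_subset)
  then obtain x y z where p: "(x, y, z) \<in> set (path_list es)"
      "x \<notin> {1..n} - S" "y \<notin> {1..n} - S" "z \<notin> {1..n} - S"
    using unhittable_sound[OF assms(1), of "{1..n} - S"] by auto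
  then have E: "(y, x) \<in> parcs G" "(y, z) \<in> parcs G" "x < z"
    by (simp_all add: path_iff)
  then have "x \<in> S" "y \<in> S" "z \<in> S"
    using p arcs[OF E(1)] arcs[OF E(2)] by simp_all
  then have "x = z"
    using S(3) E(1,2) unfolding sparse_in_def by blast
  then show False
    using E(3) by simp
qed

text \<open>All conditions pass to induced subgraphs, so a single graph provides examples on every
  smaller number of vertices.\<close>

lemma induced_not_has_dense_or_sparse:
  assumes "unhittable k (path_list es)" "n \<le> k + 7" "X \<subseteq> {1..n}"
  defines "K \<equiv> \<lparr>pverts = X, parcs = parcs G \<inter> X \<times> X\<rparr>"
  shows "pair_graph K \<and> triangle_free K \<and> \<not> has_dense_or_sparse 1 4 7 K"
proof -
  note no_C3 = girth5.no_C3[OF girth5] and no_C4 = girth5.no_C4[OF girth5]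
  have pg: "pair_graph K"
    unfolding K_def by (rule pair_graph_induced[OF assms(3)])
  have tf: "triangle_free K"
    unfolding triangle_free_def
  proof (rule notI, elim exE conjE)
    fix u v w
    assume "(u, v) \<in> parcs K" "(v, w) \<in> parcs K" "(w, u) \<in> parcs K"
    then have E: "(u, v) \<in> parcs G" "(v, w) \<in> parcs G" "(w, u) \<in> parcs G"
      by (simp_all add: K_def)
    show False
      using no_C3[OF E(1,2)] sym[OF E(3)] by contradiction
  qed
  have "girth5 (parcs K)"
  proof
    fix x y z w
    show "(y, x) \<in> parcs K" if "(x, y) \<in> parcs K"
      using that sym by (simp add: K_def)
    show "(x, z) \<notin> parcs K" if "(x, y) \<in> parcs K" "(y, z) \<in> parcs K"
      using that no_C3[of x y z] by (simp add: K_def)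
    assume "(x, y) \<in> parcs K" "(y, z) \<in> parcs K" "(x, w) \<in> parcs K" "(w, z) \<in> parcs K"
    then show "x = z \<or> y = w"
      using no_C4[of x y z w] by (simp add: K_def)
  qed
  moreover have "sparse_free (parcs K) 7 (pverts K)"
    unfolding sparse_free_def
  proof (rule notI, elim exE conjE)
    fix S assume S: "S \<subseteq> pverts K" "card S = 7" "sparse_in (parcs K) S"
    then have "sparse_in (parcs G) S" "S \<subseteq> {1..n}"
      using assms(3) by (auto simp: K_def sparse_in_def subset_iff)
    then show False
      using sparse_freeI[OF assms(1,2)] S(2) unfolding sparse_free_def by blast
  qed
  ultimately show ?thesis
    using pg tf not_has_dense_or_sparse_iff by blast
qed

lemma induced_self: "\<lparr>pverts = {1..n}, parcs = parcs G \<inter> {1..n} \<times> {1..n}\<rparr> = G"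
proof -
  have "parcs G \<subseteq> {1..n} \<times> {1..n}"
    using arcs by fast
  then have "parcs G \<inter> {1..n} \<times> {1..n} = parcs G"
    by (rule Int_absorb2)
  then show ?thesis
    by (intro pair_pre_digraph.equality) (simp_all add: pverts_eq del: One_nat_def)
qed

end

section \<open>Evaluation of the two edge lists\<close>

definition edges1 :: "(nat \<times> nat) list" where
  "edges1 = [(1,2), (2,3), (3,4), (4,5), (5,6), (1,6), (1,7), (2,8), (3,9), (4,10), (5,11), (6,12),
      (12,9), (9,11), (11,7), (7,10), (10,8), (8,12)]"

definition edges2 :: "(nat \<times> nat) list" where
  "edges2 = [(1,2), (1,9), (2,7), (2,6), (3,4), (3,7), (3,8), (4,5), (5,10), (5,6), (11,12),
      (8,9), (9,10), (10,11), (8,12), (7,11), (6,12)]"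

lemma H1_eq: "H1 = graph_of_edges {1..12} (set edges1)"
  by (simp add: H1_def edges1_def)

lemma H2_eq: "H2 = graph_of_edges {1..12} (set edges2)"
  by (simp add: H2_def edges2_def)

interpretation H1: edge_list edges1 12
  by unfold_locales code_simp+

interpretation H2: edge_list edges2 12
  by unfold_locales code_simp+

text \<open>Here 5 = 12 - 7 is the size of the complement of a 7-set.\<close>

lemma unhittable_edges1: "unhittable 5 (path_list edges1)"
  by code_simp

lemma unhittable_edges2: "unhittable 5 (path_list edges2)"
  by code_simp

lemma card_arcs_H1: "card (parcs H1) = 36"
proof -
  have "distinct (arc_list edges1)" by code_simp
  then have "card (parcs H1) = length (arc_list edges1)"
    unfolding H1_eq H1.parcs_eq by (rule distinct_card)
  then show ?thesis
    by (simp add: arc_list_def edges1_def)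
qed

lemma card_arcs_H2: "card (parcs H2) = 34"
proof -
  have "distinct (arc_list edges2)" by code_simp
  then have "card (parcs H2) = length (arc_list edges2)"
    unfolding H2_eq H2.parcs_eq by (rule distinct_card)
  then show ?thesis
    by (simp add: arc_list_def edges2_def)
qed

lemma represents_H1: "represents (parcs H1) (H_codes ! 0) [1..<13]"
  unfolding H1_eq H1.parcs_eq represents_def by code_simp

lemma represents_H2: "represents (parcs H2) (H_codes ! 1) [1..<13]"
  unfolding H2_eq H2.parcs_eq represents_def by code_simp

lemma set_upt_13: "set [1..<13] = {1..12::nat}"
  by auto

lemma H1_props:
  "pair_graph H1" "triangle_free H1" "pverts H1 = {1..12}" "\<not> has_dense_or_sparse 1 4 7 H1"
  using H1.induced_not_has_dense_or_sparse[OF unhittable_edges1, of "{1..12}"] H1.pverts_eq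
  unfolding H1.induced_self H1_eq by simp_all

lemma H2_props:
  "pair_graph H2" "triangle_free H2" "pverts H2 = {1..12}" "\<not> has_dense_or_sparse 1 4 7 H2"
  using H2.induced_not_has_dense_or_sparse[OF unhittable_edges2, of "{1..12}"] H2.pverts_eq
  unfolding H2.induced_self H2_eq by simp_all

section \<open>The Ramsey number and the extremal graphs\<close>

lemma has_dense_or_sparse_13:
  assumes "pair_graph G" "triangle_free G" "card (pverts G) = 13"
  shows "has_dense_or_sparse 1 4 7 G"
  using not_has_dense_or_sparse_iff[OF assms(1,2)] girth5.not_sparse_free_13
    pair_graph_finite[OF assms(1)] assms(3) by blast

lemma graph_iso_H1_or_H2:
  assumes G: "pair_graph G" "triangle_free G" "card (pverts G) = 12" "\<not> has_dense_or_sparse 1 4 7 G"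
  shows "graph_iso G H1 \<or> graph_iso G H2"
proof -
  have g5: "girth5 (parcs G)" "sparse_free (parcs G) 7 (pverts G)"
    using not_has_dense_or_sparse_iff[OF G(1,2)] G(4) by simp_all
  \<comment> \<open>No position is prescribed, so any value can stand for the root.\<close>
  have "listed (parcs G) [] undefined H_codes (pverts G)"
    by (rule girth5.listed_H_codes[OF g5(1) pair_graph_finite[OF G(1)] G(3) g5(2)])
  then obtain R xs where R: "R \<in> set H_codes" "represents (parcs G) R xs" "set xs = pverts G"
    by (auto simp: listed_def)
  have "R = H_codes ! 0 \<or> R = H_codes ! 1"
    using R(1) by (auto simp: H_codes_def)
  then show ?thesis
  proof
    assume R_eq: "R = H_codes ! 0"
    have "graph_iso G H1"
    proof (rule graph_iso_of_represents[OF G(1) g5(1) R(2,3) H1_props(1)])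
      show "girth5 (parcs H1)"
        unfolding H1_eq by (rule H1.girth5)
      show "represents (parcs H1) R [1..<13]"
        unfolding R_eq by (rule represents_H1)
      show "set [1..<13] = pverts H1"
        by (simp only: set_upt_13 H1_props(3))
    qed
    then show ?thesis ..
  next
    assume R_eq: "R = H_codes ! 1"
    have "graph_iso G H2"
    proof (rule graph_iso_of_represents[OF G(1) g5(1) R(2,3) H2_props(1)])
      show "girth5 (parcs H2)"
        unfolding H2_eq by (rule H2.girth5)
      show "represents (parcs H2) R [1..<13]"
        unfolding R_eq by (rule represents_H2)
      show "set [1..<13] = pverts H2"
        by (simp only: set_upt_13 H2_props(3))
    qed
    then show ?thesis ..
  qed
qed

lemma defective_ramsey_tf_1_4_7: "defective_ramsey_tf 1 4 7 = 13"
  unfolding defective_ramsey_tf_def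
proof (rule Least_equality)
  fix m
  assume all: "\<forall>G :: nat pair_pre_digraph.
    pair_graph G \<and> triangle_free G \<and> card (pverts G) = m \<longrightarrow> has_dense_or_sparse 1 4 7 G"
  \<comment> \<open>Minimality needs an example for every \<open>m < 13\<close>: the subgraph of
    \<open>H1\<close> induced on its first \<open>m\<close> vertices.\<close>
  let ?K = "\<lparr>pverts = {1..m}, parcs = parcs H1 \<inter> {1..m} \<times> {1..m}\<rparr>"
  show "13 \<le> m"
  proof (rule ccontr)
    assume "\<not> 13 \<le> m"
    then have "{1..m} \<subseteq> {1..12}" by auto
    moreover have "12 \<le> 5 + (7::nat)" by simp
    ultimately have "pair_graph ?K \<and> triangle_free ?K \<and> \<not> has_dense_or_sparse 1 4 7 ?K"
      using H1.induced_not_has_dense_or_sparse unhittable_edges1 unfolding H1_eq by blast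
    moreover have "card (pverts ?K) = m" by simp
    ultimately show False
      using all by blast
  qed
qed (use has_dense_or_sparse_13 in blast)

lemma extremal_graph_1_4_7_iff:
  "extremal_graph 1 4 7 G \<longleftrightarrow>
     pair_graph G \<and> triangle_free G \<and> card (pverts G) = 12 \<and> \<not> has_dense_or_sparse 1 4 7 G"
  unfolding extremal_graph_def defective_ramsey_tf_1_4_7 by simp

theorem theorem4p4:
  shows "defective_ramsey_tf 1 4 7 = 13
    \<and> (\<forall>G :: 'a pair_pre_digraph.
          pair_graph G \<and> triangle_free G \<and> card (pverts G) = 13 \<longrightarrow> has_dense_or_sparse 1 4 7 G)
    \<and> extremal_graph 1 4 7 H1
    \<and> extremal_graph 1 4 7 H2
    \<and> \<not> graph_iso H1 H2
    \<and> (\<forall>G :: 'a pair_pre_digraph.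
          extremal_graph 1 4 7 G \<longrightarrow> graph_iso G H1 \<or> graph_iso G H2)"
proof (intro conjI allI impI)
  show "defective_ramsey_tf 1 4 7 = 13"
    by (rule defective_ramsey_tf_1_4_7)
  show "has_dense_or_sparse 1 4 7 G"
    if "pair_graph G \<and> triangle_free G \<and> card (pverts G) = 13" for G :: "'a pair_pre_digraph"
    using that has_dense_or_sparse_13 by blast
  show "extremal_graph 1 4 7 H1" "extremal_graph 1 4 7 H2"
    using H1_props H2_props by (simp_all add: extremal_graph_1_4_7_iff del: One_nat_def)
  \<comment> \<open>\<open>H1\<close> has 18 edges and \<open>H2\<close> has 17, hence 36 and 34
    arcs.\<close>
  show "\<not> graph_iso H1 H2"
    using graph_iso_card_arcs[of H1 H2] card_arcs_H1 card_arcs_H2 by auto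
  show "graph_iso G H1 \<or> graph_iso G H2" if "extremal_graph 1 4 7 G" for G :: "'a pair_pre_digraph"
    using that graph_iso_H1_or_H2 unfolding extremal_graph_1_4_7_iff by blast
qed

end
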